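(* Fix integers $\ell\ge 2$, $a\ge 2$ and $3\le r\le 2\ell-1$. For all sufficiently large $n$, $$\max\{\mathcal N(C_{2a},G): |V(G)|=n,\ G \text{ is } C_{2\ell+1}\text{-free},\ \chi(G)\ge r\}=\mathcal N(C_{2a},T)$$ for every $T\in\mathcal T^*(r,n)$. Moreover, the extremal graphs (those attaining this maximum) are precisely the members of $\mathcal T^*(r,n)$.
   Context: Graphs are finite and simple, and membership in graph families is up to isomorphism. $\chi(G)$ is the chromatic number. $C_t$ is the cycle with $t$ vertices. $G$ is $F$-free if it contains no (not necessarily induced) subgraph isomorphic to $F$. $\mathcal N(F,G)$ is the number of unlabeled copies of $F$ in $G$, i.e. the number of subgraphs of $G$ isomorphic to $F$. $T_{m,2}$ is the complete bipartite graph with parts of sizes $\lfloor m/2\rfloor$ and $\lceil m/2\rceil$. Suspending a graph $H$ on a graph $B$ at a vertex $x\in V(B)$ means taking the disjoint union of $B$ and $H$, identifying $x$ with one vertex of $H$, and adding no further edges. $\mathcal T^*(r,n)$ is the family of graphs obtained from $T_{n-r+1,2}$ by suspending a clique $K_r$ (at any vertex). *)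

theory Defs
  imports Complex_Main
begin

record 'a graph =
  verts :: "'a set"
  edges :: "'a set set"

definition simple_graph :: "'a graph \<Rightarrow> bool" where
  "simple_graph G \<longleftrightarrow> finite (verts G) \<and> edges G \<subseteq> {e. e \<subseteq> verts G \<and> card e = 2}"

definition subgraph :: "'a graph \<Rightarrow> 'a graph \<Rightarrow> bool" where
  "subgraph H G \<longleftrightarrow> verts H \<subseteq> verts G \<and> edges H \<subseteq> edges G"

definition isomorphic :: "'a graph \<Rightarrow> 'b graph \<Rightarrow> bool" where
  "isomorphic G H \<longleftrightarrow> (\<exists>f. bij_betw f (verts G) (verts H) \<and> (`) f ` edges G = edges H)"

definition copies :: "'b graph \<Rightarrow> 'a graph \<Rightarrow> 'a graph set" where
  "copies F G = {H. simple_graph H \<and> subgraph H G \<and> isomorphic F H}"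

definition num_copies :: "'b graph \<Rightarrow> 'a graph \<Rightarrow> nat" where
  "num_copies F G = card (copies F G)"

definition free_of :: "'b graph \<Rightarrow> 'a graph \<Rightarrow> bool" where
  "free_of F G \<longleftrightarrow> \<not> (\<exists>H. simple_graph H \<and> subgraph H G \<and> isomorphic F H)"

definition colorable :: "nat \<Rightarrow> 'a graph \<Rightarrow> bool" where
  "colorable k G \<longleftrightarrow>
     (\<exists>c :: 'a \<Rightarrow> nat. c ` verts G \<subseteq> {..<k} \<and> (\<forall>u v. {u, v} \<in> edges G \<longrightarrow> c u \<noteq> c v))"

definition chromatic_number :: "'a graph \<Rightarrow> nat" where
  "chromatic_number G = (LEAST k. colorable k G)"

text \<open>This is a \<open>t\<close>-vertex cycle only for \<open>t \<ge> 3\<close>.\<close>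

definition cycle_graph :: "nat \<Rightarrow> nat graph" where
  "cycle_graph t = \<lparr>verts = {..<t}, edges = {{i, Suc i mod t} | i. i < t}\<rparr>"

definition complete_graph :: "nat \<Rightarrow> nat graph" where
  "complete_graph r = \<lparr>verts = {..<r}, edges = {{i, j} | i j. i < r \<and> j < r \<and> i \<noteq> j}\<rparr>"

text \<open>The graph $T_{m,2}$: the parts \<open>{..<m div 2}\<close> and \<open>{m div 2..<m}\<close> have
  $\lfloor m/2\rfloor$ and $\lceil m/2\rceil$ elements.\<close>

definition turan2 :: "nat \<Rightarrow> nat graph" where
  "turan2 m = \<lparr>verts = {..<m}, edges = {{u, v} | u v. u < m div 2 \<and> m div 2 \<le> v \<and> v < m}\<rparr>"

text \<open>\<open>suspend H y B x\<close> suspends \<open>H\<close> on \<open>B\<close> at \<open>x\<close>. The identified vertex is represented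
  by \<open>Inl x\<close>: it replaces the vertex \<open>y\<close> of \<open>H\<close>, all other vertices of \<open>H\<close> being tagged by \<open>Inr\<close>.\<close>

definition suspend :: "'b graph \<Rightarrow> 'b \<Rightarrow> 'a graph \<Rightarrow> 'a \<Rightarrow> ('a + 'b) graph" where
  "suspend H y B x =
     (let g = (\<lambda>h. if h = y then Inl x else Inr h) in
      \<lparr>verts = Inl ` verts B \<union> g ` verts H,
       edges = (`) Inl ` edges B \<union> (`) g ` edges H\<rparr>)"

text \<open>The family $\mathcal T^*(r,n)$, closed under isomorphism. The order $n-r+1$ of the bipartite
  graph is written \<open>n + 1 - r\<close> because of truncated subtraction.\<close>

definition Tstar :: "nat \<Rightarrow> nat \<Rightarrow> 'a graph set" where
  "Tstar r n = {G. simple_graph G \<and>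
     (\<exists>x \<in> verts (turan2 (n + 1 - r)). \<exists>y \<in> verts (complete_graph r).
        isomorphic (suspend (complete_graph r) y (turan2 (n + 1 - r)) x) G)}"

text \<open>Vertices are natural numbers, which represents every finite graph up to isomorphism.\<close>

definition admissible :: "nat \<Rightarrow> nat \<Rightarrow> nat \<Rightarrow> nat graph set" where
  "admissible l r n = {G. simple_graph G \<and> card (verts G) = n \<and>
     free_of (cycle_graph (2 * l + 1)) G \<and> chromatic_number G \<ge> r}"

end

theory Submission
  imports Defs
begin

text \<open>All copies of \<open>C\<^sub>t\<close> have the same number of traversals, that is, of cyclic lists of \<open>t\<close> distinct
vertices running along the copy. Copies may therefore be compared by counting such lists
(lemma \<open>card_cycle_lists\<close>). Let \<open>N(G)\<close> be this number for \<open>t = 2a\<close>, and let \<open>G\<close> be admissible with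
\<open>N(G)\<close> at least the number for the balanced complete bipartite graph on \<open>n - r + 1\<close> vertices.

\<^emph>\<open>Coarse structure.\<close> Without \<open>C\<^bsub>2l+1\<^esub>\<close>, no neighbourhood contains a path on \<open>2l\<close> vertices, so every
neighbourhood spans only \<open>O(n)\<close> edges. A walk ending in \<open>b\<close> is prolonged by two vertices along an
edge meeting the neighbourhood of \<open>b\<close>, and only the \<open>O(n)\<close> edges inside the neighbourhood allow two
directions. Hence \<open>N(G) \<le> 2(e + O(n))^a\<close>, which is sharp up to lower order terms, and the lower bound
on \<open>N(G)\<close> forces \<open>e \<ge> n^2/4 - O(n)\<close> (lemma \<open>edges_many\<close>). The neighbourhood \<open>S\<close> of a vertex of maximum
degree and its complement then miss only \<open>O(n)\<close> cross pairs, because the degrees outside \<open>S\<close> sum to at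
most \<open>|S|(n - |S|)\<close> (lemma \<open>max_degree_partition\<close>). After removing boundedly many vertices, both sides
form a core in which every vertex is adjacent to almost all of the other side.

\<^emph>\<open>Odd cycles.\<close> In the core there are paths of every length at least 3 that the parity permits. Let \<open>X\<close> and
\<open>Y\<close> consist of the vertices with at least \<open>\<delta>n\<close> neighbours in one or the other side of the core. An edge
inside \<open>X\<close> or \<open>Y\<close>, or a vertex with neighbours in both, would close a \<open>C\<^bsub>2l+1\<^esub>\<close>. So \<open>(X, Y)\<close> is bipartite,
and each vertex of the bounded remainder \<open>W\<close> has neighbours in at most one of \<open>X\<close> and \<open>Y\<close>.

\<^emph>\<open>Exact structure.\<close> Two colours suffice for \<open>X \<union> Y\<close>, and one of them can be reused for one vertex of \<open>W\<close>,
so chromatic number at least \<open>r\<close> implies \<open>|W| \<ge> r - 1\<close>. Every vertex missing from the bipartite part costs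
a constant times \<open>n^(2a-1)\<close> lists, while a vertex of \<open>W\<close> returns only a small multiple of \<open>\<delta> n^(2a-1)\<close>.
Therefore \<open>|W| = r - 1\<close>, and each vertex of \<open>X\<close> misses less than half of \<open>Y\<close> and conversely.
In that case the colouring argument shows that \<open>W\<close> is a clique attached to one side, say \<open>X\<close>, and two
distinct attachment vertices in \<open>X\<close> would again close a \<open>C\<^bsub>2l+1\<^esub>\<close>. So \<open>G\<close> arises from a bipartite graph by
gluing a clique \<open>K\<^sub>r\<close> at one vertex \<open>x0\<close> (lemma \<open>extremal_glued\<close>). A cycle cannot cross the cut vertex \<open>x0\<close>,
so \<open>N(G)\<close> is the number of lists in the bipartite part plus the number in the clique. The former is largest
exactly when the part is complete and balanced, which is the family \<open>Tstar r n\<close>.\<close>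


section \<open>Cycles as cyclic lists of vertices\<close>

definition adj :: "'a graph \<Rightarrow> 'a \<Rightarrow> 'a \<Rightarrow> bool" where
  "adj G u v \<longleftrightarrow> {u, v} \<in> edges G"

text \<open>The counting arguments speak only of a finite vertex set and a symmetric irreflexive adjacency relation;
\<open>fin_graph_adj\<close> instantiates this for a simple graph.\<close>

locale fin_graph =
  fixes V :: "'a set" and E :: "'a \<Rightarrow> 'a \<Rightarrow> bool"
  assumes finV: "finite V"
    and E_in: "E u v \<Longrightarrow> u \<in> V"
    and E_sym: "E u v \<Longrightarrow> E v u"
    and E_irrefl: "\<not> E u u"

definition cyclic :: "('a \<Rightarrow> 'a \<Rightarrow> bool) \<Rightarrow> 'a list \<Rightarrow> bool" where
  "cyclic E vs \<longleftrightarrow> distinct vs \<and> successively E vs \<and> E (last vs) (hd vs)"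

text \<open>The vertex set is a parameter separate from the adjacency relation, so that cycles inside a part of the
graph are counted without forming an induced subgraph.\<close>

definition cycle_lists :: "('a \<Rightarrow> 'a \<Rightarrow> bool) \<Rightarrow> 'a set \<Rightarrow> nat \<Rightarrow> 'a list set" where
  "cycle_lists E A t = {vs. length vs = t \<and> set vs \<subseteq> A \<and> cyclic E vs}"

lemma fin_graph_adj:
  assumes "simple_graph G" shows "fin_graph (verts G) (adj G)"
proof
  show "finite (verts G)" using assms by (simp add: simple_graph_def)
  show "u \<in> verts G" if "adj G u v" for u v
    using that assms by (auto simp: simple_graph_def adj_def)
  show "adj G v u" if "adj G u v" for u v
    using that by (simp add: adj_def insert_commute)
  show "\<not> adj G u u" for u
    using assms by (auto simp: simple_graph_def adj_def)
qed

lemma Suc_mod_less: "i < n \<Longrightarrow> Suc i mod n < n"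
  by (rule mod_less_divisor) simp

lemma cyclic_nth:
  assumes "length vs = t" "t > 0"
  shows "cyclic E vs \<longleftrightarrow> distinct vs \<and> (\<forall>i<t. E (vs ! i) (vs ! (Suc i mod t)))"
proof -
  have "successively E vs \<and> E (last vs) (hd vs) \<longleftrightarrow> (\<forall>i<t. E (vs ! i) (vs ! (Suc i mod t)))"
    (is "?L \<longleftrightarrow> ?R")
  proof
    assume L: ?L
    show ?R
    proof (intro allI impI)
      fix i assume "i < t"
      show "E (vs ! i) (vs ! (Suc i mod t))"
      proof (cases "Suc i = t")
        case True
        then show ?thesis using L assms
          by (metis diff_Suc_1 hd_conv_nth last_conv_nth length_greater_0_conv mod_self)
      next
        case False
        then show ?thesis using L assms \<open>i < t\<close> by (auto simp: successively_conv_nth)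
      qed
    qed
  next
    assume R: ?R
    have "E (last vs) (hd vs)"
      using R[rule_format, of "t - 1"] assms
      by (metis Suc_diff_1 diff_less hd_conv_nth last_conv_nth length_greater_0_conv mod_self zero_less_one)
    moreover have "successively E vs"
      unfolding successively_conv_nth
    proof (intro allI impI)
      fix i assume "Suc i < length vs"
      then show "E (vs ! i) (vs ! Suc i)" using R[rule_format, of i] assms by auto
    qed
    ultimately show ?L by simp
  qed
  then show ?thesis by (simp add: cyclic_def)
qed

definition cyc_graph_of :: "'a list \<Rightarrow> 'a graph" where
  "cyc_graph_of vs = \<lparr>verts = set vs,
     edges = (\<lambda>i. {vs ! i, vs ! (Suc i mod length vs)}) ` {..<length vs}\<rparr>"

definition traversals :: "nat \<Rightarrow> 'a graph \<Rightarrow> 'a list set" where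
  "traversals t H = {vs. length vs = t \<and> distinct vs \<and> cyc_graph_of vs = H}"

lemma finite_traversals: "finite (verts H) \<Longrightarrow> finite (traversals t H)"
  by (rule finite_subset[OF _ finite_lists_length_eq[of "verts H" t]])
     (auto simp: traversals_def cyc_graph_of_def)

lemma cyc_graph_of_map:
  assumes "bij_betw f (verts F) (verts H)" "(`) f ` edges F = edges H"
    "cyc_graph_of vs = F"
  shows "cyc_graph_of (map f vs) = H"
proof -
  have v: "verts F = set vs" and e: "edges F = (\<lambda>i. {vs ! i, vs ! (Suc i mod length vs)}) ` {..<length vs}"
    using assms(3) by (auto simp: cyc_graph_of_def)
  have "edges (cyc_graph_of (map f vs)) = edges H"
    unfolding assms(2)[symmetric] e cyc_graph_of_def
    by (auto simp: image_image Suc_mod_less intro!: image_cong)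
  moreover have "verts (cyc_graph_of (map f vs)) = verts H"
    using assms(1) v by (auto simp: cyc_graph_of_def bij_betw_def)
  ultimately show ?thesis by simp
qed

lemma iso_sym_map:
  assumes "bij_betw f (verts F) (verts H)" "(`) f ` edges F = edges H" "\<Union>(edges F) \<subseteq> verts F"
  shows "bij_betw (inv_into (verts F) f) (verts H) (verts F)"
    "(`) (inv_into (verts F) f) ` edges H = edges F"
proof -
  show "bij_betw (inv_into (verts F) f) (verts H) (verts F)"
    using assms(1) by (rule bij_betw_inv_into)
  have "inv_into (verts F) f ` f ` e = e" if "e \<in> edges F" for e
    using that assms(1,3) by (intro inv_into_image_cancel) (auto simp: bij_betw_def)
  then show "(`) (inv_into (verts F) f) ` edges H = edges F"
    unfolding assms(2)[symmetric] by (force simp: image_image)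
qed

text \<open>An isomorphism carries traversals to traversals; this is why every copy contributes the same number of
cyclic lists.\<close>

lemma card_traversals_iso:
  assumes "isomorphic F H" "\<Union>(edges F) \<subseteq> verts F" "finite (verts F)"
  shows "card (traversals t F) = card (traversals t H)"
proof -
  obtain f where f: "bij_betw f (verts F) (verts H)" "(`) f ` edges F = edges H"
    using assms(1) by (auto simp: isomorphic_def)
  let ?g = "inv_into (verts F) f"
  note g = iso_sym_map[OF f assms(2)]
  have vs: "set vs = verts K" if "vs \<in> traversals t K" for vs and K :: "'x graph"
    using that by (auto simp: traversals_def cyc_graph_of_def)
  have "bij_betw (map f) (traversals t F) (traversals t H)"
  proof (rule bij_betw_byWitness[where f' = "map ?g"])
    show "\<forall>a\<in>traversals t F. map ?g (map f a) = a"
      using f(1) vs[of _ F] by (auto simp: bij_betw_def intro!: map_idI)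
    show "\<forall>a\<in>traversals t H. map f (map ?g a) = a"
      using f(1) vs[of _ H] by (auto simp: bij_betw_def f_inv_into_f intro!: map_idI)
    show "map f ` traversals t F \<subseteq> traversals t H"
    proof
      fix ws assume "ws \<in> map f ` traversals t F"
      then obtain vs' where v: "vs' \<in> traversals t F" "ws = map f vs'" by auto
      then show "ws \<in> traversals t H"
        using cyc_graph_of_map[OF f] vs[OF v(1)] f(1)
        by (auto simp: traversals_def distinct_map bij_betw_def)
    qed
    show "map ?g ` traversals t H \<subseteq> traversals t F"
    proof
      fix ws assume "ws \<in> map ?g ` traversals t H"
      then obtain vs' where v: "vs' \<in> traversals t H" "ws = map ?g vs'" by auto
      then show "ws \<in> traversals t F"
        using cyc_graph_of_map[OF g] vs[OF v(1)] g(1)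
        by (auto simp: traversals_def distinct_map bij_betw_def)
    qed
  qed
  then show ?thesis by (rule bij_betw_same_card)
qed

lemma cycle_graph_eq: "cycle_graph t = cyc_graph_of [0..<t]"
  by (auto simp: cycle_graph_def cyc_graph_of_def lessThan_atLeast0 image_iff Suc_mod_less)

lemma copies_cycle:
  assumes "simple_graph G" "t \<ge> 3"
  shows "copies (cycle_graph t) G = cyc_graph_of ` cycle_lists (adj G) (verts G) t"
proof (intro set_eqI iffI)
  fix H assume "H \<in> copies (cycle_graph t) G"
  then obtain f where H: "simple_graph H" "subgraph H G" and
    f: "bij_betw f (verts (cycle_graph t)) (verts H)" "(`) f ` edges (cycle_graph t) = edges H"
    by (auto simp: copies_def isomorphic_def)
  let ?vs = "map f [0..<t]"
  have eq: "cyc_graph_of ?vs = H"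
    using cyc_graph_of_map[OF f cycle_graph_eq[symmetric]] .
  have d: "distinct ?vs" using f(1) by (auto simp: distinct_map bij_betw_def cycle_graph_def lessThan_atLeast0)
  have "?vs \<in> cycle_lists (adj G) (verts G) t"
  proof -
    have "set ?vs \<subseteq> verts G"
      using H(2) eq unfolding subgraph_def cyc_graph_of_def by auto
    moreover have "adj G (?vs ! i) (?vs ! (Suc i mod t))" if "i < t" for i
    proof -
      have "{?vs ! i, ?vs ! (Suc i mod length ?vs)} \<in> edges (cyc_graph_of ?vs)"
        using that by (simp only: cyc_graph_of_def graph.simps) auto
      then have "{?vs ! i, ?vs ! (Suc i mod length ?vs)} \<in> edges G"
        using H(2) eq by (auto simp: subgraph_def)
      then show ?thesis by (simp add: adj_def)
    qed
    ultimately show ?thesis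
      using d assms cyclic_nth[of ?vs t "adj G"] by (simp add: cycle_lists_def)
  qed
  then show "H \<in> cyc_graph_of ` cycle_lists (adj G) (verts G) t" using eq by blast
next
  fix H assume "H \<in> cyc_graph_of ` cycle_lists (adj G) (verts G) t"
  then obtain vs where vs: "length vs = t" "set vs \<subseteq> verts G" "cyclic (adj G) vs"
    and H: "H = cyc_graph_of vs" by (auto simp: cycle_lists_def)
  have d: "distinct vs" and a: "\<And>i. i < t \<Longrightarrow> adj G (vs ! i) (vs ! (Suc i mod t))"
    using vs(3) cyclic_nth[OF vs(1), of "adj G"] assms by auto
  have sub: "subgraph H G"
    using vs a by (auto simp: subgraph_def H cyc_graph_of_def adj_def)
  have simp: "simple_graph H"
  proof -
    have "e \<subseteq> set vs \<and> card e = 2" if "e \<in> edges H" for e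
    proof -
      have "card e = 2" using that sub assms by (auto simp: subgraph_def simple_graph_def)
      moreover have "e \<subseteq> set vs"
        using that vs(1) assms by (auto simp: H cyc_graph_of_def Suc_mod_less)
      ultimately show ?thesis by simp
    qed
    then show ?thesis by (auto simp: simple_graph_def H cyc_graph_of_def)
  qed
  have "isomorphic (cycle_graph t) H"
    unfolding isomorphic_def
  proof (intro exI conjI)
    show bij: "bij_betw ((!) vs) (verts (cycle_graph t)) (verts H)"
      unfolding cycle_graph_def H cyc_graph_of_def using vs(1) d
      by (auto simp: bij_betw_def inj_on_def nth_eq_iff_index_eq set_conv_nth)
    show "(`) ((!) vs) ` edges (cycle_graph t) = edges H"
      unfolding cycle_graph_def H cyc_graph_of_def using vs(1)
      by (auto simp: image_def)
  qed
  then show "H \<in> copies (cycle_graph t) G" using sub simp by (simp add: copies_def)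
qed

text \<open>The fibres of the map from cyclic lists to copies are the sets of traversals, all of the size found in the
model cycle. Being positive and the same for all graphs, this factor does not affect comparisons.\<close>

lemma card_cycle_lists:
  assumes "simple_graph G" "t \<ge> 3"
  shows "card (cycle_lists (adj G) (verts G) t) =
    card (traversals t (cycle_graph t)) * num_copies (cycle_graph t) G"
proof -
  let ?C = "cycle_lists (adj G) (verts G) t"
  have finC: "finite ?C"
    by (rule finite_subset[OF _ finite_lists_length_eq[of "verts G" t]])
       (use assms in \<open>auto simp: cycle_lists_def simple_graph_def\<close>)
  have fib: "{vs \<in> ?C. cyc_graph_of vs = H} = traversals t H" if "H \<in> cyc_graph_of ` ?C" for H
  proof (intro set_eqI iffI)
    fix vs assume "vs \<in> traversals t H"
    then have vs: "length vs = t" "distinct vs" "cyc_graph_of vs = H" by (auto simp: traversals_def)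
    have sub: "subgraph H G" using that copies_cycle[OF assms] by (auto simp: copies_def)
    have "set vs \<subseteq> verts G" using sub vs by (auto simp: subgraph_def cyc_graph_of_def)
    moreover have "adj G (vs ! i) (vs ! (Suc i mod t))" if "i < t" for i
    proof -
      have "{vs ! i, vs ! (Suc i mod t)} \<in> edges (cyc_graph_of vs)"
        using that vs by (auto simp: cyc_graph_of_def)
      then show ?thesis using sub vs by (auto simp: subgraph_def adj_def)
    qed
    ultimately have "vs \<in> ?C" using vs cyclic_nth[of vs t "adj G"] assms(2) by (simp add: cycle_lists_def)
    then show "vs \<in> {vs \<in> ?C. cyc_graph_of vs = H}" using vs by simp
  qed (auto simp: traversals_def cycle_lists_def cyclic_def)
  have "card ?C = (\<Sum>H\<in>cyc_graph_of ` ?C. card {vs \<in> ?C. cyc_graph_of vs = H})"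
    using sum.group[of ?C "cyc_graph_of ` ?C" cyc_graph_of "\<lambda>_. 1::nat"] finC by simp
  also have "\<dots> = (\<Sum>H\<in>cyc_graph_of ` ?C. card (traversals t (cycle_graph t)))"
  proof (rule sum.cong[OF refl])
    fix H assume H: "H \<in> cyc_graph_of ` ?C"
    then have "isomorphic (cycle_graph t) H" using copies_cycle[OF assms] by (auto simp: copies_def)
    then have "card (traversals t (cycle_graph t)) = card (traversals t H)"
      by (rule card_traversals_iso) (use assms in \<open>auto simp: cycle_graph_def\<close>)
    then show "card {vs \<in> ?C. cyc_graph_of vs = H} = card (traversals t (cycle_graph t))"
      using fib[OF H] by simp
  qed
  also have "\<dots> = card (traversals t (cycle_graph t)) * num_copies (cycle_graph t) G"
    using copies_cycle[OF assms] by (simp add: num_copies_def)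
  finally show ?thesis .
qed

lemma card_traversals_pos: "card (traversals t (cycle_graph t)) > 0"
  using finite_traversals[of "cycle_graph t" t]
  by (auto simp: card_gt_0_iff cycle_graph_def traversals_def cycle_graph_eq[unfolded cycle_graph_def, symmetric]
      intro!: exI[of _ "[0..<t]"])

lemma free_of_cycle:
  assumes "simple_graph G" "t \<ge> 3"
  shows "free_of (cycle_graph t) G \<longleftrightarrow> cycle_lists (adj G) (verts G) t = {}"
  using copies_cycle[OF assms] by (auto simp: free_of_def copies_def)

section \<open>Walks, edge density and the maximum degree partition\<close>

lemma card_ordered_edges_Sigma:
  assumes "finite A" "finite B"
  shows "card {(u, v). u \<in> A \<and> v \<in> B \<and> R u v} = (\<Sum>u\<in>A. card {v \<in> B. R u v})"
proof -
  have "{(u, v). u \<in> A \<and> v \<in> B \<and> R u v} = Sigma A (\<lambda>u. {v \<in> B. R u v})" by auto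
  then show ?thesis using assms by simp
qed

context fin_graph begin

definition nbrs :: "'a \<Rightarrow> 'a set" where "nbrs v = {u. E v u}"

text \<open>Ordered pairs: an edge inside \<open>A \<inter> B\<close> is counted twice, so \<open>ordered_edges V V\<close> is twice the number of edges.\<close>

definition ordered_edges :: "'a set \<Rightarrow> 'a set \<Rightarrow> nat" where
  "ordered_edges A B = card {(u, v). u \<in> A \<and> v \<in> B \<and> E u v}"

lemma nbrs_sub: "nbrs v \<subseteq> V" using E_in E_sym by (auto simp: nbrs_def)

lemma finite_nbrs [simp]: "finite (nbrs v)" using nbrs_sub finV finite_subset by blast

lemma mem_nbrs [simp]: "u \<in> nbrs v \<longleftrightarrow> E v u" by (simp add: nbrs_def)

lemma ordered_edges_sum:
  assumes "finite A" "finite B" shows "ordered_edges A B = (\<Sum>u\<in>A. card (nbrs u \<inter> B))"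
  unfolding ordered_edges_def card_ordered_edges_Sigma[OF assms] by (intro sum.cong refl arg_cong[where f = card]) auto

lemma finite_ordered_edges: assumes "finite A" "finite B" shows "finite {(u, v). u \<in> A \<and> v \<in> B \<and> E u v}"
  by (rule finite_subset[of _ "A \<times> B"]) (use assms in auto)

lemma ordered_edges_sym: "ordered_edges A B = ordered_edges B A"
  unfolding ordered_edges_def
  by (rule bij_betw_same_card[where f = "\<lambda>(u, v). (v, u)"])
     (auto simp: bij_betw_def inj_on_def image_def intro: E_sym)

lemma ordered_edges_Un_right:
  assumes "finite A" "finite B" "finite C" "B \<inter> C = {}"
  shows "ordered_edges A (B \<union> C) = ordered_edges A B + ordered_edges A C"
proof -
  have "card (nbrs u \<inter> (B \<union> C)) = card (nbrs u \<inter> B) + card (nbrs u \<inter> C)" for u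
    using assms by (subst card_Un_disjoint[symmetric]) (auto simp: Int_Un_distrib)
  then show ?thesis using assms by (simp add: ordered_edges_sum sum.distrib)
qed

lemma ordered_edges_Un_left:
  assumes "finite A" "finite B" "finite C" "B \<inter> C = {}"
  shows "ordered_edges (B \<union> C) A = ordered_edges B A + ordered_edges C A"
  using ordered_edges_Un_right[OF assms] by (simp add: ordered_edges_sym)

text \<open>A path on fewer than \<open>k + 1\<close> vertices cannot use up the \<open>k\<close> neighbours of its endpoint, so it extends.\<close>

lemma path_from_min_degree:
  assumes "finite S" "S \<noteq> {}" "\<And>v. v \<in> S \<Longrightarrow> card (nbrs v \<inter> S) \<ge> k" "j \<le> k"
  shows "\<exists>vs. length vs = Suc j \<and> distinct vs \<and> set vs \<subseteq> S \<and> successively E vs"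
  using assms(4)
proof (induction j)
  case 0
  obtain v where "v \<in> S" using assms(2) by auto
  then show ?case by (intro exI[of _ "[v]"]) auto
next
  case (Suc j)
  then obtain vs where vs: "length vs = Suc j" "distinct vs" "set vs \<subseteq> S" "successively E vs"
    by auto
  then have ne: "vs \<noteq> []" by auto
  have "hd vs \<in> S" using vs(3) ne by auto
  then have c: "card (nbrs (hd vs) \<inter> S) > j" using assms(3) Suc.prems by fastforce
  have "\<not> nbrs (hd vs) \<inter> S \<subseteq> set (tl vs)"
  proof
    assume "nbrs (hd vs) \<inter> S \<subseteq> set (tl vs)"
    then have "card (nbrs (hd vs) \<inter> S) \<le> card (set (tl vs))" by (intro card_mono) auto
    also have "\<dots> \<le> j" using card_length[of "tl vs"] vs(1) by simp
    finally show False using c by simp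
  qed
  then obtain w where w: "E (hd vs) w" "w \<in> S" "w \<notin> set (tl vs)" using mem_nbrs by blast
  have "w \<noteq> hd vs" using w(1) E_irrefl by auto
  then have "w \<notin> set vs" using w(3) ne by (cases vs) auto
  then show ?case using vs w E_sym ne
    by (intro exI[of _ "w # vs"]) (auto simp: successively_Cons)
qed

text \<open>A weak form of the Erdos-Gallai theorem. Without a path on \<open>k + 1\<close> vertices some vertex has degree below
\<open>k\<close>; deleting it removes fewer than \<open>2k\<close> ordered pairs, and induction applies.\<close>

lemma sparse_if_no_path:
  assumes "finite S" "k > 0"
    "\<not> (\<exists>vs. length vs = Suc k \<and> distinct vs \<and> set vs \<subseteq> S \<and> successively E vs)"
  shows "ordered_edges S S \<le> 2 * k * card S"
  using assms(1,3)
proof (induction "card S" arbitrary: S)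
  case 0
  then show ?case by (simp add: ordered_edges_def)
next
  case (Suc m)
  then have "S \<noteq> {}" by auto
  with path_from_min_degree[OF Suc.prems(1) this, of k k] Suc.prems(2)
  obtain v where v: "v \<in> S" "card (nbrs v \<inter> S) < k" by (meson linorder_not_le order_refl)
  let ?S = "S - {v}"
  have m: "m = card ?S" using Suc v by simp
  have IH: "ordered_edges ?S ?S \<le> 2 * k * card ?S"
    by (rule Suc.hyps(1)[OF m]) (use Suc.prems in blast)+
  have S: "S = ?S \<union> {v}" using v by auto
  have "ordered_edges S S = ordered_edges ?S ?S + ordered_edges ?S {v} + (ordered_edges {v} ?S + ordered_edges {v} {v})"
    using Suc.prems(1) ordered_edges_Un_left[of S ?S "{v}"] ordered_edges_Un_right[of ?S ?S "{v}"]
      ordered_edges_Un_right[of "{v}" ?S "{v}"] S by simp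
  moreover have "ordered_edges {v} {v} = 0" using E_irrefl by (simp add: ordered_edges_sum)
  moreover have "ordered_edges {v} ?S \<le> k" 
  proof -
    have "ordered_edges {v} ?S = card (nbrs v \<inter> ?S)" using Suc.prems(1) by (simp add: ordered_edges_sum)
    also have "\<dots> \<le> card (nbrs v \<inter> S)" by (intro card_mono) auto
    finally show ?thesis using v by simp
  qed
  moreover have "ordered_edges ?S {v} = ordered_edges {v} ?S" by (rule ordered_edges_sym)
  ultimately have "ordered_edges S S \<le> 2 * k * card ?S + 2 * k" using IH by simp
  also have "\<dots> = 2 * k * card S" using v Suc.prems(1) m Suc.hyps(2) by (metis add.commute mult_Suc_right)
  finally show ?case .
qed

text \<open>A path on \<open>2l\<close> vertices inside a neighbourhood, closed through the common neighbour, is a cycle of length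
\<open>2l + 1\<close>.\<close>

lemma nbrs_sparse:
  assumes "cycle_lists E V (2 * l + 1) = {}" "l \<ge> 1"
  shows "ordered_edges (nbrs v) (nbrs v) \<le> 4 * l * card (nbrs v)"
proof -
  have "ordered_edges (nbrs v) (nbrs v) \<le> 2 * (2 * l - 1) * card (nbrs v)"
  proof (rule sparse_if_no_path)
    show "\<not> (\<exists>vs. length vs = Suc (2 * l - 1) \<and> distinct vs \<and> set vs \<subseteq> nbrs v \<and> successively E vs)"
    proof
      assume "\<exists>vs. length vs = Suc (2 * l - 1) \<and> distinct vs \<and> set vs \<subseteq> nbrs v \<and> successively E vs"
      then obtain vs where vs: "length vs = 2 * l" "distinct vs" "set vs \<subseteq> nbrs v" "successively E vs"
        using assms(2) by auto
      then have ne: "vs \<noteq> []" using assms(2) by auto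
      have hd: "E v (hd vs)" "E (last vs) v" using vs(3) ne E_sym last_in_set[of vs] hd_in_set[of vs] mem_nbrs by blast+
      have "v \<notin> set vs" using vs(3) E_irrefl by auto
      then have "v # vs \<in> cycle_lists E V (2 * l + 1)"
        using vs hd ne nbrs_sub[of v] E_in by (auto simp: cycle_lists_def cyclic_def successively_Cons)
      then show False using assms by auto
    qed
  qed (use assms in auto)
  also have "\<dots> \<le> 4 * l * card (nbrs v)" by (intro mult_right_mono) auto
  finally show ?thesis .
qed

text \<open>The continuations of a walk from \<open>b\<close> by two vertices are the ordered edges that start in the neighbourhood
of \<open>b\<close>. Reversing those that end outside gives ordered edges not counted before, so twice their number
exceeds the number of all ordered edges by at most those inside the neighbourhood.\<close>

lemma two_step_bound:
  "2 * (\<Sum>c\<in>nbrs b. card (nbrs c)) \<le> ordered_edges V V + ordered_edges (nbrs b) (nbrs b)"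
proof -
  let ?N = "nbrs b" and ?M = "V - nbrs b"
  have V: "V = ?N \<union> ?M" using nbrs_sub by auto
  have fin: "finite ?M" using finV by simp
  have "ordered_edges V V = ordered_edges ?N ?N + ordered_edges ?N ?M + (ordered_edges ?M ?N + ordered_edges ?M ?M)"
    using fin by (subst (1 2) V, subst ordered_edges_Un_left) (auto simp: ordered_edges_Un_right simp del: Un_Diff_cancel)
  moreover have "ordered_edges ?M ?N = ordered_edges ?N ?M" by (rule ordered_edges_sym)
  moreover have "(\<Sum>c\<in>nbrs b. card (nbrs c)) = ordered_edges ?N V"
    using finV nbrs_sub by (simp add: ordered_edges_sum Int_absorb2)
  moreover have "ordered_edges ?N V = ordered_edges ?N ?N + ordered_edges ?N ?M"
    using fin by (subst V, subst ordered_edges_Un_right) auto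
  ultimately show ?thesis by simp
qed

definition walks :: "nat \<Rightarrow> 'a list set" where
  "walks t = {vs. length vs = t \<and> set vs \<subseteq> V \<and> successively E vs}"

lemma finite_walks: "finite (walks t)"
  by (rule finite_subset[OF _ finite_lists_length_eq[OF finV, of t]]) (auto simp: walks_def)

lemma finite_cycle_lists: "A \<subseteq> V \<Longrightarrow> finite (cycle_lists E A t)"
  by (rule finite_subset[OF _ finite_lists_length_eq[OF finV, of t]]) (auto simp: cycle_lists_def)

text \<open>Walks are prolonged two vertices at a time by \<open>two_step_bound\<close>. For a bipartite graph, where
neighbourhoods span no edges, this is the bound \<open>2 e^k\<close>, attained by complete bipartite graphs.\<close>

lemma card_walks_bound:
  fixes Q :: real
  assumes Q: "\<And>b. real (ordered_edges V V + ordered_edges (nbrs b) (nbrs b)) \<le> 2 * Q"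
  shows "real (card (walks (2 * Suc k))) \<le> 2 * Q ^ Suc k"
proof (induction k)
  case 0
  have "walks 2 = (\<lambda>(u, v). [u, v]) ` {(u, v). u \<in> V \<and> v \<in> V \<and> E u v}"
    by (auto simp: walks_def length_Suc_conv numeral_2_eq_2 image_iff)
  then have "card (walks 2) \<le> ordered_edges V V"
    unfolding ordered_edges_def by (auto intro!: card_image_le finite_ordered_edges finV)
  then show ?case using Q[of undefined] by simp
next
  case (Suc k)
  let ?W = "walks (2 * Suc k)"
  let ?X = "Sigma ?W (\<lambda>vs. Sigma (nbrs (hd vs)) nbrs)"
  have sub: "walks (2 * Suc (Suc k)) \<subseteq> (\<lambda>(vs, c, d). d # c # vs) ` ?X"
  proof
    fix ws assume ws: "ws \<in> walks (2 * Suc (Suc k))"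
    then obtain d c vs where ws': "ws = d # c # vs"
      by (auto simp: walks_def length_Suc_conv)
    then have ne: "vs \<noteq> []" using ws by (auto simp: walks_def)
    have "vs \<in> ?W" "c \<in> nbrs (hd vs)" "d \<in> nbrs c"
      using ws ws' ne E_sym by (auto simp: walks_def successively_Cons)
    then show "ws \<in> (\<lambda>(vs, c, d). d # c # vs) ` ?X" using ws' by force
  qed
  have finX: "finite ?X" using finite_walks by auto
  have "card (walks (2 * Suc (Suc k))) \<le> card ?X"
    using sub finX by (rule surj_card_le[rotated])
  also have "card ?X = (\<Sum>vs\<in>?W. \<Sum>c\<in>nbrs (hd vs). card (nbrs c))"
    using finite_walks by simp
  finally have "real (card (walks (2 * Suc (Suc k)))) \<le> (\<Sum>vs\<in>?W. real (\<Sum>c\<in>nbrs (hd vs). card (nbrs c)))"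
    by (metis of_nat_le_iff of_nat_sum)
  also have "\<dots> \<le> (\<Sum>vs\<in>?W. Q)"
  proof (rule sum_mono)
    fix vs
    have "2 * real (\<Sum>c\<in>nbrs (hd vs). card (nbrs c)) \<le> real (ordered_edges V V + ordered_edges (nbrs (hd vs)) (nbrs (hd vs)))"
      using two_step_bound[of "hd vs"] by linarith
    also have "\<dots> \<le> 2 * Q" by (rule Q)
    finally show "real (\<Sum>c\<in>nbrs (hd vs). card (nbrs c)) \<le> Q" by simp
  qed
  also have "\<dots> = real (card ?W) * Q" by simp
  also have "\<dots> \<le> 2 * Q ^ Suc k * Q"
  proof (rule mult_right_mono[OF Suc])
    show "Q \<ge> 0" using Q[of undefined] by linarith
  qed
  finally show ?case by (simp add: mult_ac)
qed

text \<open>Every cyclic list is a walk, so many even cycles force \<open>Q \<ge> B^2\<close> for the quantity \<open>Q\<close> of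
\<open>card_walks_bound\<close>, that is, many edges.\<close>

lemma edges_many:
  fixes B :: real
  assumes "cycle_lists E V (2 * l + 1) = {}" "l \<ge> 1" "a \<ge> 1" "B \<ge> 0"
    "real (card (cycle_lists E V (2 * a))) \<ge> 2 * B ^ (2 * a)"
  shows "real (ordered_edges V V) \<ge> 2 * B\<^sup>2 - 4 * l * card V"
proof -
  \<comment> \<open>the number of edges plus the error term from the edges inside a neighbourhood\<close>
  let ?Q = "(real (ordered_edges V V) + 4 * l * card V) / 2"
  obtain k where k: "a = Suc k" using assms(3) by (cases a) auto
  have "2 * B ^ (2 * a) \<le> real (card (cycle_lists E V (2 * a)))" by fact
  also have "\<dots> \<le> real (card (walks (2 * a)))"
    by (intro of_nat_mono card_mono finite_walks) (auto simp: cycle_lists_def walks_def cyclic_def)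
  also have "\<dots> \<le> 2 * ?Q ^ a"
    unfolding k
  proof (rule card_walks_bound)
    fix b
    have "ordered_edges (nbrs b) (nbrs b) \<le> 4 * l * card (nbrs b)" using nbrs_sparse[OF assms(1,2)] .
    also have "\<dots> \<le> 4 * l * card V" using nbrs_sub finV by (intro mult_left_mono card_mono) auto
    finally have "real (ordered_edges (nbrs b) (nbrs b)) \<le> real (4 * l * card V)" by linarith
    then show "real (ordered_edges V V + ordered_edges (nbrs b) (nbrs b)) \<le> 2 * ?Q" by simp
  qed
  finally have "(B\<^sup>2) ^ a \<le> ?Q ^ a" by (simp add: power_mult)
  then have "B\<^sup>2 \<le> ?Q"
    by (rule power_le_imp_le_base[where n = k, folded k]) auto
  then show ?thesis by simp
qed

text \<open>Take for \<open>S\<close> the neighbourhood of a vertex of maximum degree. It spans few edges, and the vertices of the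
complement \<open>T\<close> have total degree at most \<open>|S||T| \<le> n^2/4\<close>. A graph with almost \<open>n^2/4\<close> edges leaves
almost no slack in either bound.\<close>

lemma max_degree_partition:
  fixes c :: real
  assumes free: "cycle_lists E V (2 * l + 1) = {}" "l \<ge> 1"
    and e: "real (ordered_edges V V) \<ge> (real (card V))\<^sup>2 / 2 - c * card V"
  obtains S T where "S \<union> T = V" "S \<inter> T = {}"
    "real (card S * card T) - real (ordered_edges S T) \<le> (c + 4 * l) * card V"
    "(real (card S) - real (card T))\<^sup>2 \<le> 2 * (c + 4 * l) * card V"
proof (cases "V = {}")
  case True
  then show ?thesis using that[of "{}" "{}"] by (simp add: ordered_edges_def)
next
  case False
  let ?n = "real (card V)"
  have "Max ((\<lambda>v. card (nbrs v)) ` V) \<in> (\<lambda>v. card (nbrs v)) ` V"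
    using finV False by (intro Max_in) auto
  then obtain u where u: "u \<in> V" "card (nbrs u) = Max ((\<lambda>v. card (nbrs v)) ` V)" by auto
  have max: "card (nbrs v) \<le> card (nbrs u)" if "v \<in> V" for v
    using that finV u(2) by auto
  define S T where "S = nbrs u" and "T = V - S"
  have V: "V = S \<union> T" and disj: "S \<inter> T = {}" and fin: "finite S" "finite T"
    using nbrs_sub finV by (auto simp: S_def T_def)
  have cV: "card V = card S + card T" using card_Un_disjoint[OF fin disj] V by simp
  have PV: "ordered_edges V V = ordered_edges S S + 2 * ordered_edges S T + ordered_edges T T"
    using fin disj ordered_edges_sym[of T S] by (subst (1 2) V, subst ordered_edges_Un_left) (auto simp: ordered_edges_Un_right)
  have "ordered_edges T V = (\<Sum>v\<in>T. card (nbrs v))"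
    using finV nbrs_sub fin by (simp add: ordered_edges_sum Int_absorb2)
  also have "\<dots> \<le> (\<Sum>v\<in>T. card S)" using max by (intro sum_mono) (auto simp: T_def S_def)
  finally have "ordered_edges T V \<le> card S * card T" by (simp add: mult.commute)
  moreover have "ordered_edges T V = ordered_edges S T + ordered_edges T T"
    using fin disj ordered_edges_sym[of T S] by (subst V, subst ordered_edges_Un_right) auto
  ultimately have T: "real (ordered_edges S T) + real (ordered_edges T T) \<le> real (card S * card T)" by linarith
  have "ordered_edges S S \<le> 4 * l * card S" using nbrs_sparse[OF free] by (simp add: S_def)
  also have "\<dots> \<le> 4 * l * card V" using cV by simp
  finally have SS: "real (ordered_edges S S) \<le> 4 * l * ?n"
    by (metis of_nat_le_iff of_nat_mult of_nat_numeral)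
  have sq: "(real (card S) - real (card T))\<^sup>2 = ?n\<^sup>2 - 4 * real (card S * card T)"
    by (simp add: cV power2_eq_square algebra_simps)
  have sq0: "(real (card S) - real (card T))\<^sup>2 \<ge> 0" by simp
  have PV': "real (ordered_edges V V) = real (ordered_edges S S) + 2 * real (ordered_edges S T) + real (ordered_edges T T)"
    using PV by simp
  have split: "(c + 4 * l) * ?n = c * ?n + 4 * l * ?n" "2 * (c + 4 * l) * ?n = 2 * (c * ?n) + 2 * (4 * l * ?n)"
    by (simp_all add: algebra_simps)
  show ?thesis
  proof (rule that[of S T])
    show "real (card S * card T) - real (ordered_edges S T) \<le> (c + 4 * l) * ?n"
      unfolding split using T SS e PV' sq sq0 by linarith
    have "real (ordered_edges T T) \<ge> 0" by simp
    then show "(real (card S) - real (card T))\<^sup>2 \<le> 2 * (c + 4 * l) * ?n"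
      unfolding split using T SS e PV' sq by linarith
  qed (use V disj in auto)
qed

end

section \<open>Even cycles in bipartite graphs\<close>

definition falling :: "nat \<Rightarrow> nat \<Rightarrow> nat" where "falling s a = (\<Prod>i<a. s - i)"

lemma falling_0 [simp]: "falling s 0 = 1" by (simp add: falling_def)

lemma falling_Suc: "falling s (Suc a) = falling s a * (s - a)" by (simp add: falling_def)

lemma falling_Suc_Suc: "falling (Suc s) (Suc a) = Suc s * falling s a"
  unfolding falling_def by (subst prod.lessThan_Suc_shift) simp

lemma falling_pos: "a \<le> s \<Longrightarrow> falling s a > 0" by (auto simp: falling_def)

lemma falling_ge: "(s - a) ^ a \<le> falling s a"
proof -
  have "(\<Prod>i<a. s - a) \<le> (\<Prod>i<a. s - i)" by (intro prod_mono) auto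
  then show ?thesis by (simp add: falling_def)
qed

lemma falling_step: "falling s (Suc a) + Suc a * falling s a \<le> falling (Suc s) (Suc a)"
proof (cases "a \<le> s")
  case True
  then have "Suc s * falling s a = (s - a) * falling s a + Suc a * falling s a"
    by (simp flip: add_mult_distrib)
  then show ?thesis unfolding falling_Suc_Suc falling_Suc[of s] by (simp add: mult.commute)
next
  case False
  then have "falling s a = 0" by (auto simp: falling_def intro!: bexI[of _ s])
  then show ?thesis by (simp add: falling_Suc)
qed

text \<open>After cancelling the common factors this is \<open>(x + 1)(y - b) < (x - b)(y + 1)\<close> with \<open>b = a - 1\<close>; the
difference of the two sides is \<open>a(x - y)\<close>.\<close>

lemma falling_balance:
  assumes "y < x" "a \<ge> 1"
  shows "falling (Suc x) a * falling y a \<le> falling x a * falling (Suc y) a"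
    "a \<le> Suc y \<Longrightarrow> falling (Suc x) a * falling y a < falling x a * falling (Suc y) a"
proof -
  obtain b where b: "a = Suc b" using assms by (cases a) auto
  have *: "Suc x * (y - b) < (x - b) * Suc y" if bley: "b \<le> y"
  proof -
    obtain d where d: "y = b + d" using le_Suc_ex[OF bley] by auto
    obtain e where e: "x = Suc (y + e)" using assms(1) less_iff_Suc_add by auto
    show ?thesis using d unfolding e by (simp add: algebra_simps)
  qed
  have L: "falling (Suc x) a * falling y a = (Suc x * (y - b)) * (falling x b * falling y b)"
    by (simp add: b falling_Suc_Suc[of x] falling_Suc[of y] algebra_simps)
  have R: "falling x a * falling (Suc y) a = ((x - b) * Suc y) * (falling x b * falling y b)"
    by (simp add: b falling_Suc_Suc[of y] falling_Suc[of x] algebra_simps)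
  show "falling (Suc x) a * falling y a < falling x a * falling (Suc y) a" if "a \<le> Suc y"
    unfolding L R using * that assms b by (intro mult_strict_right_mono) (auto simp: falling_pos)
  then show "falling (Suc x) a * falling y a \<le> falling x a * falling (Suc y) a"
    unfolding L R using * by (cases "b \<le> y") (auto simp: mult_right_mono less_imp_le)
qed

text \<open>The number of cyclic lists of length \<open>2a\<close> in the balanced complete bipartite graph on \<open>m\<close> vertices; the
factor 2 is the choice of the side in which a list starts.\<close>

definition balanced_count :: "nat \<Rightarrow> nat \<Rightarrow> nat" where
  "balanced_count a m = 2 * falling (m div 2) a * falling (m - m div 2) a"

lemma falling_prod_le_balanced_count:
  assumes "a \<ge> 1" "y \<le> x"
  shows "2 * falling x a * falling y a \<le> balanced_count a (x + y)"
  using assms(2)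
proof (induction "x - y" arbitrary: x y rule: less_induct)
  case less
  show ?case
  proof (cases "x \<le> Suc y")
    case True
    then have "x = y \<or> x = Suc y" using less.prems by auto
    then show ?thesis by (auto simp: balanced_count_def mult_ac)
  next
    case False
    then obtain x' where x': "x = Suc x'" "y < x'" by (cases x) auto
    have "2 * falling x a * falling y a \<le> 2 * falling x' a * falling (Suc y) a"
      using falling_balance(1)[OF x'(2) assms(1)] x' by simp
    also have "\<dots> \<le> balanced_count a (x' + Suc y)" by (rule less.hyps) (use x' in auto)
    finally show ?thesis using x' by simp
  qed
qed

lemma falling_prod_less_balanced_count:
  assumes "a \<ge> 1" "Suc y < x" "a \<le> y"
  shows "2 * falling x a * falling y a < balanced_count a (x + y)"
proof -
  obtain x' where x': "x = Suc x'" "y < x'" using assms by (cases x) auto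
  have "2 * falling x a * falling y a < 2 * falling x' a * falling (Suc y) a"
    using falling_balance(2)[OF x'(2) assms(1)] x' assms by simp
  also have "\<dots> \<le> balanced_count a (x' + Suc y)" by (rule falling_prod_le_balanced_count) (use x' assms in auto)
  finally show ?thesis using x' by simp
qed

lemma falling_prod_balanced_count:
  assumes "a \<ge> 1"
  shows "2 * falling x a * falling y a \<le> balanced_count a (x + y)"
  using falling_prod_le_balanced_count[OF assms, of x y] falling_prod_le_balanced_count[OF assms, of y x]
  by (cases "x \<le> y") (auto simp: add.commute mult_ac)

lemma falling_prod_balanced_count_eq:
  assumes "a \<ge> 1" "a \<le> x" "a \<le> y" "2 * falling x a * falling y a = balanced_count a (x + y)"
  shows "x = (x + y) div 2 \<or> y = (x + y) div 2"
  using falling_prod_less_balanced_count[of a y x] falling_prod_less_balanced_count[of a x y] assms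
  by (cases "x \<le> y"; force simp: add.commute mult_ac)

text \<open>One more vertex enlarges one of the two parts, and by \<open>falling_step\<close> the falling factorial of that part
grows by at least \<open>a\<close> times a falling factorial of order \<open>a - 1\<close>. This is the price, of order
\<open>m^(2a-1)\<close>, of keeping a vertex out of the bipartite part.\<close>

lemma balanced_count_step:
  assumes "s + a \<le> m div 2" "a \<ge> 1"
  shows "balanced_count a m + 2 * a * s ^ (2 * a - 1) \<le> balanced_count a (Suc m)"
proof -
  obtain b where b: "a = Suc b" using assms by (cases a) auto
  define u v where "u = m div 2" and "v = m - m div 2"
  have *: "2 * falling p a * falling q a + 2 * a * s ^ (2 * a - 1) \<le> 2 * falling p a * falling (Suc q) a"
    if "s + a \<le> p" "s + a \<le> q" for p q
  proof -
    have 1: "s ^ a \<le> falling p a"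
      by (rule order_trans[OF power_mono[of s "p - a"] falling_ge]) (use that in auto)
    have 2: "s ^ b \<le> falling q b"
      by (rule order_trans[OF power_mono[of s "q - b"] falling_ge]) (use that b in auto)
    have "2 * a - 1 = a + b" using b by simp
    then have "s ^ (2 * a - 1) = s ^ a * s ^ b" by (simp only: power_add)
    also have "\<dots> \<le> falling p a * falling q b" using 1 2 by (rule mult_mono) auto
    finally have "a * s ^ (2 * a - 1) \<le> falling p a * (a * falling q b)"
      by (simp add: mult.left_commute)
    then have "falling p a * falling q a + a * s ^ (2 * a - 1) \<le> falling p a * (falling q a + a * falling q b)"
      by (simp add: algebra_simps)
    also have "\<dots> \<le> falling p a * falling (Suc q) a" using falling_step[of q b] b by (intro mult_left_mono) auto
    finally show ?thesis by simp
  qed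
  have uv: "s + a \<le> u" "s + a \<le> v" using assms(1) by (auto simp: u_def v_def)
  have "balanced_count a (Suc m) = 2 * falling u a * falling (Suc v) a \<or> balanced_count a (Suc m) = 2 * falling v a * falling (Suc u) a"
  proof (cases "even m")
    case True
    then show ?thesis by (auto simp: balanced_count_def u_def v_def elim!: evenE)
  next
    case False
    then show ?thesis by (auto simp: balanced_count_def u_def v_def elim!: oddE)
  qed
  moreover have "balanced_count a m = 2 * falling u a * falling v a" by (simp add: balanced_count_def u_def v_def)
  ultimately show ?thesis using *[OF uv] *[OF uv(2,1)] by (auto simp: mult_ac)
qed

lemma balanced_count_steps:
  assumes "s + a \<le> m div 2" "a \<ge> 1"
  shows "balanced_count a m + j * (2 * a * s ^ (2 * a - 1)) \<le> balanced_count a (m + j)"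
proof (induction j)
  case (Suc j)
  have "balanced_count a (m + j) + 2 * a * s ^ (2 * a - 1) \<le> balanced_count a (Suc (m + j))"
    by (rule balanced_count_step) (use assms in \<open>auto intro: order_trans[OF _ div_le_mono]\<close>)
  then show ?case using Suc by simp
qed simp

text \<open>Lists \<open>x\<^sub>1, y\<^sub>1, ..., x\<^sub>a, y\<^sub>a\<close> of distinct vertices of \<open>X\<close> and \<open>Y\<close> in turn, when \<open>X\<close> and
\<open>Y\<close> are disjoint: exactly the cyclic lists of the complete bipartite graph that start in \<open>X\<close>.\<close>

fun alternating :: "nat \<Rightarrow> 'a set \<Rightarrow> 'a set \<Rightarrow> 'a list set" where
  "alternating 0 X Y = {[]}"
| "alternating (Suc a) X Y = {x # y # vs |x y vs. vs \<in> alternating a X Y \<and> x \<in> X - set vs \<and> y \<in> Y - set vs}"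

lemma alternating_sub: "vs \<in> alternating a X Y \<Longrightarrow> set vs \<subseteq> X \<union> Y \<and> length vs = 2 * a"
  by (induction a arbitrary: vs) fastforce+

lemma alternating_card_Int:
  assumes "X \<inter> Y = {}" "vs \<in> alternating a X Y"
  shows "card (set vs \<inter> X) = a \<and> card (set vs \<inter> Y) = a"
  using assms(2)
proof (induction a arbitrary: vs)
  case (Suc a)
  then obtain x y ws where vs: "vs = x # y # ws" "ws \<in> alternating a X Y" "x \<in> X - set ws" "y \<in> Y - set ws"
    by auto
  then have "x \<notin> Y" "y \<notin> X" using assms(1) by auto
  then have "set vs \<inter> X = insert x (set ws \<inter> X)" "set vs \<inter> Y = insert y (set ws \<inter> Y)"
    using vs by auto
  then show ?case using Suc.IH[OF vs(2)] vs by auto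
qed simp

lemma card_alternating:
  assumes "finite X" "finite Y" "X \<inter> Y = {}"
  shows "finite (alternating a X Y) \<and> card (alternating a X Y) = falling (card X) a * falling (card Y) a"
proof (induction a)
  case (Suc a)
  let ?S = "Sigma (alternating a X Y) (\<lambda>vs. (X - set vs) \<times> (Y - set vs))"
  have eq: "alternating (Suc a) X Y = (\<lambda>(vs, x, y). x # y # vs) ` ?S" by (auto simp: image_iff)
  have inj: "inj_on (\<lambda>(vs, x, y). x # y # vs) ?S" by (auto simp: inj_on_def)
  have "card ?S = (\<Sum>vs\<in>alternating a X Y. card ((X - set vs) \<times> (Y - set vs)))"
    using Suc assms by (intro card_SigmaI) auto
  also have "\<dots> = (\<Sum>vs\<in>alternating a X Y. (card X - a) * (card Y - a))"
  proof (rule sum.cong[OF refl])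
    fix vs assume vs: "vs \<in> alternating a X Y"
    have "card (X - set vs) = card X - a" "card (Y - set vs) = card Y - a"
      using alternating_card_Int[OF assms(3) vs] by (auto simp: card_Diff_subset_Int Int_commute)
    then show "card ((X - set vs) \<times> (Y - set vs)) = (card X - a) * (card Y - a)"
      by (simp add: card_cartesian_product)
  qed
  also have "\<dots> = falling (card X) (Suc a) * falling (card Y) (Suc a)" using Suc by (simp add: falling_Suc)
  finally show ?case unfolding eq using Suc assms by (simp add: card_image[OF inj] del: alternating.simps)
qed simp

lemma alternating_I:
  assumes "distinct vs" "successively R vs" "set vs \<subseteq> X \<union> Y" "length vs = 2 * a" "X \<inter> Y = {}"
    "\<And>u v. R u v \<Longrightarrow> u \<in> X \<union> Y \<Longrightarrow> v \<in> X \<union> Y \<Longrightarrow> (u \<in> X \<longleftrightarrow> v \<in> Y)"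
    "vs = [] \<or> hd vs \<in> X"
  shows "vs \<in> alternating a X Y"
  using assms(1-4,7)
proof (induction a arbitrary: vs)
  case (Suc a)
  then obtain x y ws where vs: "vs = x # y # ws" by (auto simp: length_Suc_conv)
  have x: "x \<in> X" using Suc.prems vs by auto
  have R: "R x y" "ws = [] \<or> R y (hd ws)" using Suc.prems(2) vs
    by (auto simp: successively_Cons)
  have y: "y \<in> Y" using R x Suc.prems(3) vs assms(6)[of x y] by auto
  have "ws = [] \<or> hd ws \<in> X"
  proof (cases "ws = []")
    case False
    have "set ws \<subseteq> X \<union> Y" using Suc.prems(3) vs by auto
    then have "hd ws \<in> X \<union> Y" using hd_in_set[OF False] by blast
    moreover have "R y (hd ws)" using R False by simp
    ultimately show ?thesis using assms(5) y assms(6)[of y "hd ws"] by auto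
  qed simp
  then have "ws \<in> alternating a X Y"
    using Suc.prems vs by (intro Suc.IH) (auto simp: successively_Cons)
  then show ?case using x y vs Suc.prems(1) by auto
qed simp

lemma alternating_cyclic:
  assumes "vs \<in> alternating a X Y" "X \<inter> Y = {}" "\<And>x y. x \<in> X \<Longrightarrow> y \<in> Y \<Longrightarrow> R x y \<and> R y x"
  shows "distinct vs \<and> successively R vs \<and> (vs \<noteq> [] \<longrightarrow> hd vs \<in> X \<and> last vs \<in> Y)"
  using assms(1)
proof (induction a arbitrary: vs)
  case (Suc a)
  then obtain x y ws where vs: "vs = x # y # ws" "ws \<in> alternating a X Y" "x \<in> X - set ws" "y \<in> Y - set ws"
    by auto
  show ?case using Suc.IH[OF vs(2)] vs assms(2,3) by (auto simp: successively_Cons)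
qed simp

context fin_graph begin

definition bipartition :: "'a set \<Rightarrow> 'a set \<Rightarrow> bool" where
  "bipartition X Y \<longleftrightarrow> X \<subseteq> V \<and> Y \<subseteq> V \<and> X \<inter> Y = {} \<and>
     (\<forall>u v. E u v \<longrightarrow> \<not> (u \<in> X \<and> v \<in> X) \<and> \<not> (u \<in> Y \<and> v \<in> Y))"

lemma bipartition_sym: "bipartition X Y \<Longrightarrow> bipartition Y X"
  by (auto simp: bipartition_def)

lemma cycle_lists_bipartition_sub:
  assumes "bipartition X Y" 
  shows "cycle_lists E (X \<union> Y) (2 * a) \<subseteq> alternating a X Y \<union> alternating a Y X"
proof
  fix vs assume "vs \<in> cycle_lists E (X \<union> Y) (2 * a)"
  then have vs: "length vs = 2 * a" "set vs \<subseteq> X \<union> Y" "distinct vs" "successively E vs"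
    by (auto simp: cycle_lists_def cyclic_def)
  have "vs = [] \<or> hd vs \<in> X \<or> hd vs \<in> Y" using vs(2) hd_in_set[of vs] by blast
  moreover have "vs \<in> alternating a X Y" if "vs = [] \<or> hd vs \<in> X"
    by (rule alternating_I[of _ E]) (use vs that assms in \<open>auto simp: bipartition_def\<close>)
  moreover have "vs \<in> alternating a Y X" if "hd vs \<in> Y"
    by (rule alternating_I[of _ E]) (use vs that assms in \<open>auto simp: bipartition_def\<close>)
  ultimately show "vs \<in> alternating a X Y \<union> alternating a Y X" by blast
qed

lemma alternating_disjoint:
  assumes "a \<ge> 1" "X \<inter> Y = {}" shows "alternating a X Y \<inter> alternating a Y X = {}"
  using assms by (cases a) auto

lemma card_alternating_both:
  assumes "bipartition X Y" "a \<ge> 1"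
  shows "finite (alternating a X Y \<union> alternating a Y X)"
    "card (alternating a X Y \<union> alternating a Y X) = 2 * falling (card X) a * falling (card Y) a"
proof -
  have fin: "finite X" "finite Y" "X \<inter> Y = {}" "Y \<inter> X = {}"
    using assms finV finite_subset by (auto simp: bipartition_def)
  note c = card_alternating[OF fin(1,2,3), of a] card_alternating[OF fin(2,1,4), of a]
  show "finite (alternating a X Y \<union> alternating a Y X)" using c by simp
  show "card (alternating a X Y \<union> alternating a Y X) = 2 * falling (card X) a * falling (card Y) a"
    using c alternating_disjoint[OF assms(2) fin(3)] by (subst card_Un_disjoint) auto
qed

text \<open>Each vertex \<open>y\<close> not adjacent to \<open>x\<close> rules out all alternating lists beginning with \<open>x, y\<close>. The
surplus term yields both the approximate statement that \<open>x\<close> misses few vertices and, at the end, that none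
is missed in an extremal graph.\<close>

lemma card_cycle_lists_bipartition:
  assumes "bipartition X Y" "x \<in> X" "a \<ge> 1"
  shows "card (cycle_lists E (X \<union> Y) (2 * a)) + card (Y - nbrs x) * (falling (card X - 1) (a - 1) * falling (card Y - 1) (a - 1))
     \<le> 2 * falling (card X) a * falling (card Y) a"
proof -
  obtain b where b: "a = Suc b" using assms by (cases a) auto
  have fin: "finite X" "finite Y" "X \<inter> Y = {}"
    using assms finV finite_subset by (auto simp: bipartition_def)
  \<comment> \<open>alternating lists beginning with \<open>x\<close> and a vertex not adjacent to it\<close>
  let ?B = "(\<lambda>(y, vs). x # y # vs) ` Sigma (Y - nbrs x) (\<lambda>y. alternating b (X - {x}) (Y - {y}))"
  let ?A = "alternating a X Y \<union> alternating a Y X"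
  have alternating_mono: "alternating k X' Y' \<subseteq> alternating k X Y" if "X' \<subseteq> X" "Y' \<subseteq> Y" for k and X' Y' :: "'a set"
    using that by (induction k) auto
  have sub: "?B \<subseteq> ?A"
  proof -
    have "x # y # vs \<in> alternating a X Y" if "y \<in> Y" "vs \<in> alternating b (X - {x}) (Y - {y})" for y vs
    proof -
      have "set vs \<subseteq> (X - {x}) \<union> (Y - {y})" using alternating_sub[OF that(2)] by simp
      moreover have "vs \<in> alternating b X Y" using alternating_mono[of "X - {x}" "Y - {y}" b] that(2) by auto
      ultimately show ?thesis using that assms(2) fin(3) b by auto
    qed
    then show ?thesis by auto
  qed
  have disj: "cycle_lists E (X \<union> Y) (2 * a) \<inter> ?B = {}"
    by (auto simp: cycle_lists_def cyclic_def successively_Cons)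
  have cB: "card ?B = card (Y - nbrs x) * (falling (card X - 1) (a - 1) * falling (card Y - 1) (a - 1))"
  proof -
    have "card ?B = card (Sigma (Y - nbrs x) (\<lambda>y. alternating b (X - {x}) (Y - {y})))"
      by (rule card_image) (auto simp: inj_on_def)
    also have "\<dots> = (\<Sum>y\<in>Y - nbrs x. card (alternating b (X - {x}) (Y - {y})))"
    proof (intro card_SigmaI ballI)
      fix y assume "y \<in> Y - nbrs x"
      show "finite (alternating b (X - {x}) (Y - {y}))"
        using card_alternating[of "X - {x}" "Y - {y}" b] fin by auto
    qed (use fin in auto)
    also have "\<dots> = (\<Sum>y\<in>Y - nbrs x. falling (card X - 1) b * falling (card Y - 1) b)"
    proof (rule sum.cong[OF refl])
      fix y assume "y \<in> Y - nbrs x"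
      then show "card (alternating b (X - {x}) (Y - {y})) = falling (card X - 1) b * falling (card Y - 1) b"
        using card_alternating[of "X - {x}" "Y - {y}" b] fin assms(2) by auto
    qed
    finally show ?thesis by (simp add: b)
  qed
  have "card (cycle_lists E (X \<union> Y) (2 * a)) + card ?B = card (cycle_lists E (X \<union> Y) (2 * a) \<union> ?B)"
  proof (rule card_Un_disjoint[symmetric, OF _ _ disj])
    show "finite (cycle_lists E (X \<union> Y) (2 * a))" "finite ?B"
      using finite_subset[OF cycle_lists_bipartition_sub[OF assms(1)]] card_alternating_both(1)[OF assms(1,3)]
        finite_subset[OF sub] by blast+
  qed
  also have "\<dots> \<le> card ?A"
    by (intro card_mono card_alternating_both(1)[OF assms(1,3)]) (use cycle_lists_bipartition_sub[OF assms(1)] sub in auto)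
  finally show ?thesis using cB card_alternating_both(2)[OF assms(1,3)] by simp
qed

lemma card_cycle_lists_bipartition_le:
  assumes "bipartition X Y" "a \<ge> 1"
  shows "card (cycle_lists E (X \<union> Y) (2 * a)) \<le> 2 * falling (card X) a * falling (card Y) a"
  using card_mono[OF card_alternating_both(1)[OF assms] cycle_lists_bipartition_sub[OF assms(1)]]
    card_alternating_both(2)[OF assms] by simp

lemma card_cycle_lists_complete_bipartite:
  assumes "bipartition X Y" "a \<ge> 1" "\<And>x y. x \<in> X \<Longrightarrow> y \<in> Y \<Longrightarrow> E x y"
  shows "card (cycle_lists E (X \<union> Y) (2 * a)) = 2 * falling (card X) a * falling (card Y) a"
proof -
  have disj: "X \<inter> Y = {}" "Y \<inter> X = {}" using assms(1) by (auto simp: bipartition_def)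
  have "vs \<in> cycle_lists E (X \<union> Y) (2 * a)" if "vs \<in> alternating a X Y" for vs
    using alternating_cyclic[OF that disj(1), of E] alternating_sub[OF that] assms E_sym
    by (cases "vs = []") (auto simp: cycle_lists_def cyclic_def)
  moreover have "vs \<in> cycle_lists E (X \<union> Y) (2 * a)" if "vs \<in> alternating a Y X" for vs
    using alternating_cyclic[OF that disj(2), of E] alternating_sub[OF that] assms E_sym
    by (cases "vs = []") (auto simp: cycle_lists_def cyclic_def)
  ultimately have "cycle_lists E (X \<union> Y) (2 * a) = alternating a X Y \<union> alternating a Y X"
    using cycle_lists_bipartition_sub[OF assms(1), of a] by blast
  then show ?thesis using card_alternating_both(2)[OF assms(1,2)] by simp
qed

lemma cycle_lists_bipartition_odd:
  assumes "bipartition X Y" shows "cycle_lists E (X \<union> Y) (2 * a + 1) = {}"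
proof (rule ccontr)
  assume "cycle_lists E (X \<union> Y) (2 * a + 1) \<noteq> {}"
  then obtain us where us: "us \<in> cycle_lists E (X \<union> Y) (Suc (2 * a))" by auto
  then obtain v vs where "us = v # vs" by (cases us) (auto simp: cycle_lists_def)
  with us have vs: "length vs = 2 * a" "set (v # vs) \<subseteq> X \<union> Y" "distinct vs"
    "successively E (v # vs)" "E (last (v # vs)) v"
    by (auto simp: cycle_lists_def cyclic_def)
  have a: "a \<ge> 1" using vs E_irrefl by (cases a) auto
  then have ne: "vs \<noteq> []" using vs by auto
  have False if XY: "bipartition X Y" "v \<in> Y" "set vs \<subseteq> X \<union> Y" for X Y
  proof -
    have "hd vs \<in> X \<union> Y" using that(3) hd_in_set[OF ne] by blast
    then have hd: "hd vs \<in> X" using that(1,2) vs(4) ne by (auto simp: successively_Cons bipartition_def)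
    have "vs \<in> alternating a X Y"
      by (rule alternating_I[of _ E]) (use vs that hd in \<open>auto simp: bipartition_def successively_Cons\<close>)
    then have "last vs \<in> Y" using alternating_cyclic[of vs a X Y "\<lambda>_ _. True"] ne XY by (auto simp: bipartition_def)
    then show False using vs(5) XY ne by (auto simp: bipartition_def)
  qed
  from this[OF assms] this[OF bipartition_sym[OF assms]] vs(2) show False by (auto simp: Un_commute)
qed

end

section \<open>Paths of prescribed length and colourings\<close>

lemma ex_notin:
  assumes "finite F" "card F < card A" shows "\<exists>a\<in>A. a \<notin> F"
proof (rule ccontr)
  assume "\<not> ?thesis"
  then have "A \<subseteq> F" by auto
  from card_mono[OF assms(1) this] assms(2) show False by simp
qed

lemma card_Un_le2: "card (F \<union> {p, q}) \<le> card F + 2"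
  using card_Un_le[of F "{p, q}"] card_insert_le_m1[of 2 "{q}" p] by simp

context fin_graph begin

text \<open>A path of \<open>k\<close> edges from \<open>p\<close> to \<open>q\<close>. The avoided set \<open>F\<close> lets such paths be lengthened by induction
and closed to cycles through prescribed further vertices.\<close>

definition path_avoiding :: "'a set \<Rightarrow> nat \<Rightarrow> 'a \<Rightarrow> 'a \<Rightarrow> bool" where
  "path_avoiding F k p q \<longleftrightarrow> (\<exists>vs. length vs = Suc k \<and> hd vs = p \<and> last vs = q \<and> distinct vs \<and>
     successively E vs \<and> set vs \<inter> F = {})"

lemma path_avoiding_Cons:
  assumes "E w p" "path_avoiding (insert w F) k p q" "w \<notin> F"
  shows "path_avoiding F (Suc k) w q"
proof -
  obtain vs where vs: "length vs = Suc k" "hd vs = p" "last vs = q" "distinct vs"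
     "successively E vs" "set vs \<inter> insert w F = {}" using assms(2) by (auto simp: path_avoiding_def)
  then show ?thesis using assms(1,3)
    by (auto simp: path_avoiding_def successively_Cons intro!: exI[of _ "w # vs"])
qed

lemma path_avoiding_snoc:
  assumes "path_avoiding (insert w F) k p q" "E q w" "w \<notin> F"
  shows "path_avoiding F (Suc k) p w"
proof -
  obtain vs where vs: "length vs = Suc k" "hd vs = p" "last vs = q" "distinct vs"
     "successively E vs" "set vs \<inter> insert w F = {}" using assms(1) by (auto simp: path_avoiding_def)
  then have "vs \<noteq> []" by auto
  then show ?thesis using assms(2,3) vs
    by (auto simp: path_avoiding_def successively_append_iff intro!: exI[of _ "vs @ [w]"])
qed

lemma path_avoiding_close:
  assumes "path_avoiding F k p q" "E q p"
  shows "cycle_lists E V (Suc k) \<noteq> {}"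
proof -
  obtain vs where vs: "length vs = Suc k" "hd vs = p" "last vs = q" "distinct vs"
     "successively E vs" using assms(1) by (auto simp: path_avoiding_def)
  have cyc: "cyclic E vs" using vs assms(2) by (simp add: cyclic_def)
  have "vs ! i \<in> V" if "i < length vs" for i
    using cyclic_nth[of vs "Suc k" E] cyc vs that E_in by auto
  then have "set vs \<subseteq> V" by (auto simp: in_set_conv_nth)
  then show ?thesis using cyc vs by (auto simp: cycle_lists_def)
qed

text \<open>The last two conditions ensure that every vertex still has \<open>D\<close> neighbours on the other side. With \<open>D\<close> well
above \<open>m\<close>, boundedly many forbidden vertices can be avoided at each step of a path.\<close>

definition near_complete :: "nat \<Rightarrow> nat \<Rightarrow> 'a set \<Rightarrow> 'a set \<Rightarrow> bool" where
  "near_complete m D X Y \<longleftrightarrow> X \<subseteq> V \<and> Y \<subseteq> V \<and> X \<inter> Y = {} \<and>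
     (\<forall>x\<in>X. card (Y - nbrs x) \<le> m) \<and> (\<forall>y\<in>Y. card (X - nbrs y) \<le> m) \<and>
     D + m \<le> card X \<and> D + m \<le> card Y"

lemma near_complete_sym: "near_complete m D X Y \<Longrightarrow> near_complete m D Y X"
  by (auto simp: near_complete_def)

lemma near_complete_deg:
  assumes "near_complete m D X Y" "x \<in> X" shows "D \<le> card (nbrs x \<inter> Y)"
proof -
  have fin: "finite Y" using assms finV finite_subset by (auto simp: near_complete_def)
  have "card Y = card (Y - nbrs x) + card (nbrs x \<inter> Y)"
    using fin by (subst card_Un_disjoint[symmetric]) (auto intro: arg_cong[where f = card])
  then show ?thesis using assms by (fastforce simp: near_complete_def)
qed

text \<open>For length 3, choose a neighbour \<open>x\<close> of \<open>q\<close>; it misses at most \<open>m\<close> of the \<open>D\<close> neighbours of \<open>p\<close>, so it is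
adjacent to an allowed one. Longer paths first walk back and forth from \<open>p\<close> into the core. The endpoints
need not lie in the core: \<open>D\<close> neighbours there are enough.\<close>

lemma path_avoiding_odd:
  assumes nc: "near_complete m D X Y" and "finite F" "card F + 2 * k + m + 3 \<le> D"
    "p \<notin> F" "q \<notin> F" "p \<noteq> q" "D \<le> card (nbrs p \<inter> Y)" "D \<le> card (nbrs q \<inter> X)"
  shows "path_avoiding F (2 * k + 3) p q"
  using assms(2-)
proof (induction k arbitrary: p F)
  case 0
  have disj: "X \<inter> Y = {}" and finY: "finite Y"
    using nc finV finite_subset by (auto simp: near_complete_def)
  have "card (F \<union> {p, q}) < card (nbrs q \<inter> X)" using 0 card_Un_le2[of F p q] by linarith
  with ex_notin[of "F \<union> {p, q}" "nbrs q \<inter> X"] 0 obtain x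
    where x: "E q x" "x \<in> X" "x \<notin> F" "x \<noteq> p" "x \<noteq> q" by auto
  have "card (Y - nbrs x) \<le> m" using nc x by (auto simp: near_complete_def)
  then have "card (F \<union> {p, q} \<union> (Y - nbrs x)) < card (nbrs p \<inter> Y)"
    using 0 card_Un_le2[of F p q] card_Un_le[of "F \<union> {p, q}" "Y - nbrs x"] by linarith
  with ex_notin[of "F \<union> {p, q} \<union> (Y - nbrs x)" "nbrs p \<inter> Y"] 0 finY obtain y
    where y: "E p y" "y \<in> Y" "y \<notin> F" "y \<noteq> p" "y \<noteq> q" "E x y" by auto
  have "x \<noteq> y" using x y disj by auto
  then show ?case using x y 0 E_sym
    by (auto simp: path_avoiding_def intro!: exI[of _ "[p, y, x, q]"])
next
  case (Suc k)
  have disj: "X \<inter> Y = {}" using nc by (auto simp: near_complete_def)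
  have "card (F \<union> {p, q}) < card (nbrs p \<inter> Y)" using Suc.prems card_Un_le2[of F p q] by linarith
  with ex_notin[of "F \<union> {p, q}" "nbrs p \<inter> Y"] Suc.prems obtain y
    where y: "E p y" "y \<in> Y" "y \<notin> F" "y \<noteq> p" "y \<noteq> q" by auto
  have "card (F \<union> {p, q}) < card (nbrs y \<inter> X)"
    using Suc.prems card_Un_le2[of F p q] near_complete_deg[OF near_complete_sym[OF nc] y(2)] by linarith
  with ex_notin[of "F \<union> {p, q}" "nbrs y \<inter> X"] Suc.prems obtain x
    where x: "E y x" "x \<in> X" "x \<notin> F" "x \<noteq> p" "x \<noteq> q" by auto
  have "path_avoiding (F \<union> {p, y}) (2 * k + 3) x q"
  proof (rule Suc.IH)
    show "card (F \<union> {p, y}) + 2 * k + m + 3 \<le> D" using Suc.prems card_Un_le2[of F p y] by simp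
    show "D \<le> card (nbrs x \<inter> Y)" using near_complete_deg[OF nc x(2)] .
  qed (use x y disj Suc.prems in auto)
  then have "path_avoiding (insert y (insert p F)) (2 * k + 3) x q" by (simp add: insert_commute)
  then have "path_avoiding (insert p F) (Suc (2 * k + 3)) y q" by (rule path_avoiding_Cons[OF x(1)]) (use y in auto)
  then have "path_avoiding F (Suc (Suc (2 * k + 3))) p q" by (rule path_avoiding_Cons[OF y(1)]) (use Suc.prems in auto)
  then show ?case by (simp add: numeral_3_eq_3)
qed

lemma path_avoiding_even:
  assumes nc: "near_complete m D X Y" and "finite F" "card F + 2 * k + m + 4 \<le> D"
    "p \<notin> F" "q \<notin> F" "p \<noteq> q" "D \<le> card (nbrs p \<inter> Y)" "D \<le> card (nbrs q \<inter> Y)"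
  shows "path_avoiding F (2 * k + 4) p q"
proof -
  have "card (F \<union> {p, q}) < card (nbrs q \<inter> Y)" using assms card_Un_le2[of F p q] by linarith
  with ex_notin[of "F \<union> {p, q}" "nbrs q \<inter> Y"] assms obtain y
    where y: "E q y" "y \<in> Y" "y \<notin> F" "y \<noteq> p" "y \<noteq> q" by auto
  have "path_avoiding (insert q F) (2 * k + 3) p y"
  proof (rule path_avoiding_odd[OF nc])
    show "card (insert q F) + 2 * k + m + 3 \<le> D" using assms by (simp add: card_insert_if)
    show "D \<le> card (nbrs y \<inter> X)" using near_complete_deg[OF near_complete_sym[OF nc] y(2)] .
  qed (use assms y in auto)
  then have "path_avoiding F (Suc (2 * k + 3)) p q" using path_avoiding_snoc y(1) E_sym assms by blast
  then show ?thesis by (simp add: eval_nat_numeral)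
qed

text \<open>With \<open>Y\<close> one side of the core these are the vertices that can join the opposite side. The bound \<open>D\<close> will be
a small multiple of \<open>n\<close>, so that the vertices left out lie on few cycles.\<close>

definition well_attached :: "nat \<Rightarrow> 'a set \<Rightarrow> 'a set" where
  "well_attached D Y = {v \<in> V. D \<le> card (nbrs v \<inter> Y)}"

context
  fixes l m D X1 Y1
  assumes free: "cycle_lists E V (2 * l + 1) = {}" and l2: "l \<ge> 2"
    and nc: "near_complete m D X1 Y1" and D: "m + 2 * l + 4 \<le> D"
begin

text \<open>The two ends of an edge would be joined by a path of length \<open>2l\<close>.\<close>

lemma well_attached_indep:
  assumes "p \<in> well_attached D Y1" "q \<in> well_attached D Y1" shows "\<not> E p q"
proof
  assume "E p q"
  then have "p \<noteq> q" using E_irrefl by auto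
  then have "path_avoiding {} (2 * (l - 2) + 4) p q"
    using assms l2 D by (intro path_avoiding_even[OF nc]) (auto simp: well_attached_def)
  moreover have "Suc (2 * (l - 2) + 4) = 2 * l + 1" using l2 by simp
  ultimately show False using path_avoiding_close[of "{}" _ p q] \<open>E p q\<close> E_sym free by metis
qed

text \<open>The two neighbours of \<open>w\<close> would be joined by a path of length \<open>2l - 1\<close> avoiding \<open>w\<close>.\<close>

lemma not_both_sides_aux:
  assumes "p \<in> well_attached D Y1" "q \<in> well_attached D X1" "p \<noteq> q" "E w p" "E w q"
  shows False
proof -
  have "w \<noteq> p" "w \<noteq> q" using assms E_irrefl by auto
  then have "path_avoiding {w} (2 * (l - 2) + 3) p q"
    using assms l2 D by (intro path_avoiding_odd[OF nc]) (auto simp: well_attached_def)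
  then have "path_avoiding {} (Suc (2 * (l - 2) + 3)) w q" using assms by (intro path_avoiding_Cons) auto
  moreover have "Suc (Suc (2 * (l - 2) + 3)) = 2 * l + 1" using l2 by simp
  ultimately show False using path_avoiding_close[of "{}" _ w q] assms E_sym free by metis
qed

lemma core_sub: "X1 \<subseteq> well_attached D Y1" "Y1 \<subseteq> well_attached D X1"
  using near_complete_deg[OF nc] near_complete_deg[OF near_complete_sym[OF nc]] nc
  by (auto simp: well_attached_def near_complete_def)

text \<open>A common vertex would have neighbours in both sides of the core, contradicting \<open>not_both_sides_aux\<close>.\<close>

lemma well_attached_disjoint: "well_attached D Y1 \<inter> well_attached D X1 = {}"
proof (rule ccontr)
  assume "\<not> ?thesis"
  then obtain p where p: "p \<in> well_attached D Y1" "p \<in> well_attached D X1" by auto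
  have "card (nbrs p \<inter> X1) > 0" "card (nbrs p \<inter> Y1) > 0" using p D l2 by (auto simp: well_attached_def)
  then obtain x y where "E p x" "x \<in> X1" "E p y" "y \<in> Y1" by (auto simp: card_gt_0_iff)
  moreover have "x \<noteq> y" using calculation nc by (auto simp: near_complete_def)
  ultimately show False using not_both_sides_aux[of x y p] core_sub by blast
qed

lemma not_both_sides:
  assumes "p \<in> well_attached D Y1" "q \<in> well_attached D X1" "E w p" "E w q"
  shows False
  using not_both_sides_aux[OF assms(1,2) _ assms(3,4)] well_attached_disjoint assms by auto

end

lemma bipartition_well_attached:
  assumes "cycle_lists E V (2 * l + 1) = {}" "l \<ge> 2" "near_complete m D X1 Y1" "m + 2 * l + 4 \<le> D"
  shows "bipartition (well_attached D Y1) (well_attached D X1)"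
  unfolding bipartition_def
  using well_attached_indep[OF assms] well_attached_disjoint[OF assms]
    well_attached_indep[OF assms(1,2) near_complete_sym[OF assms(3)] assms(4)]
  by (auto simp: well_attached_def)

definition proper_colorable :: "nat \<Rightarrow> bool" where
  "proper_colorable k \<longleftrightarrow> (\<exists>c :: 'a \<Rightarrow> nat. c ` V \<subseteq> {..<k} \<and> (\<forall>u v. E u v \<longrightarrow> c u \<noteq> c v))"

text \<open>Colours 0 and 1 serve \<open>X\<close>, \<open>Y\<close> and, through \<open>s\<close>, the set \<open>U\<close>; each other outside vertex gets a colour of
its own.\<close>

lemma proper_colorable_extend:
  assumes bip: "bipartition X Y" and W: "W = V - (X \<union> Y)" and U: "U \<subseteq> W"
    and s: "\<And>u. u \<in> U \<Longrightarrow> s u \<in> {0, 1}"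
      "\<And>u x. u \<in> U \<Longrightarrow> x \<in> X \<Longrightarrow> E u x \<Longrightarrow> s u \<noteq> 0"
      "\<And>u y. u \<in> U \<Longrightarrow> y \<in> Y \<Longrightarrow> E u y \<Longrightarrow> s u \<noteq> 1"
      "\<And>u u'. u \<in> U \<Longrightarrow> u' \<in> U \<Longrightarrow> E u u' \<Longrightarrow> s u \<noteq> (s u' :: nat)"
    and k: "card (W - U) + 2 \<le> k"
  shows "proper_colorable k"
proof -
  have "finite (W - U)" using W finV by auto
  then obtain f where f: "inj_on f (W - U)" "f ` (W - U) = {0..<card (W - U)}"
    using ex_bij_betw_finite_nat[of "W - U"] by (auto simp: bij_betw_def)
  define c where "c v = (if v \<in> X then 0 else if v \<in> Y then 1 else if v \<in> U then s v else 2 + f v)" for v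
  have flt: "f v < card (W - U)" if "v \<in> W - U" for v using f(2) that by force
  have "c v < k" if "v \<in> V" for v
    using that flt[of v] k s(1)[of v] W by (auto simp: c_def)
  moreover have "c u \<noteq> c v" if e: "E u v" for u v
  proof -
    have V: "u \<in> V" "v \<in> V" "E v u" "u \<noteq> v" using e E_in E_sym E_irrefl by blast+
    have cX: "c v = 0" if "v \<in> X" for v using that by (simp add: c_def)
    have cY: "c v = 1" if "v \<in> Y" for v using that bip by (auto simp: c_def bipartition_def)
    have cU: "c v = s v" if "v \<in> U" for v using that U W by (auto simp: c_def)
    have cW: "c v = 2 + f v" if "v \<in> W - U" for v using that W by (auto simp: c_def)
    have parts: "v \<in> X \<or> v \<in> Y \<or> v \<in> U \<or> v \<in> W - U" if "v \<in> V" for v using that W by blast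
    have ind: "\<not> (u \<in> X \<and> v \<in> X)" "\<not> (u \<in> Y \<and> v \<in> Y)"
      using bip e unfolding bipartition_def by blast+
    have low: "c v \<le> 1" if "v \<in> X \<or> v \<in> Y \<or> v \<in> U" for v
      using that cX cY cU s(1) by force
    show ?thesis
    proof (cases "u \<in> W - U \<or> v \<in> W - U")
      case True
      show ?thesis
      proof
        assume eq: "c u = c v"
        have high: "c v \<ge> 2" if "v \<in> W - U" for v using cW[OF that] by simp
        have "u \<in> W - U" "v \<in> W - U"
          using True high[of u] high[of v] low[of u] low[of v] eq parts[OF V(1)] parts[OF V(2)]
          by fastforce+
        then show False using cW[of u] cW[of v] eq inj_onD[OF f(1), of u v] V(4) by simp
      qed
    next
      case False
      have "c u \<noteq> c v" if "u \<in> X"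
        using that ind(1) False parts[OF V(2)] cX[of u] cY[of v] cU[of v] s(2)[of v u] V(3) by auto
      moreover have "c u \<noteq> c v" if "u \<in> Y"
        using that ind(2) False parts[OF V(2)] cX[of v] cY[of u] cU[of v] s(3)[of v u] V(3) by auto
      moreover have "c u \<noteq> c v" if "u \<in> U"
        using that False parts[OF V(2)] cX[of v] cY[of v] cU[of u] cU[of v] s(2)[of u v] s(3)[of u v] s(4)[of u v] e by auto
      ultimately show ?thesis using False parts[OF V(1)] by blast
    qed
  qed
  ultimately show ?thesis unfolding proper_colorable_def by (intro exI[of _ c]) auto
qed

text \<open>An outside vertex can take colour 0 or colour 1, since it has neighbours on at most one side. Reusing these
colours for one vertex gives the first claim. If \<open>|W| = r - 1\<close>, they cannot be reused for two vertices at
once; so any two are adjacent, and no two prefer different colours, which puts all of them on the same side.\<close>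

lemma not_proper_colorable_outside:
  assumes bip: "bipartition X Y" and W: "W = V - (X \<union> Y)"
    and one: "\<And>w x y. w \<in> W \<Longrightarrow> x \<in> X \<Longrightarrow> y \<in> Y \<Longrightarrow> E w x \<Longrightarrow> E w y \<Longrightarrow> False"
    and ncol: "\<not> proper_colorable (r - 1)" and r: "r \<ge> 3"
  shows "r - 1 \<le> card W"
    "card W = r - 1 \<Longrightarrow> (\<forall>w\<in>W. \<forall>w'\<in>W. w \<noteq> w' \<longrightarrow> E w w') \<and>
      ((\<forall>w\<in>W. (\<exists>x\<in>X. E w x) \<and> (\<forall>y\<in>Y. \<not> E w y)) \<or> (\<forall>w\<in>W. (\<exists>y\<in>Y. E w y) \<and> (\<forall>x\<in>X. \<not> E w x)))"
proof -
  have finW: "finite W" using W finV by auto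
  show "r - 1 \<le> card W"
  proof (rule ccontr)
    assume small: "\<not> r - 1 \<le> card W"
    show False
    proof (cases "W = {}")
      case True
      have "proper_colorable (r - 1)"
        by (rule proper_colorable_extend[OF bip W, of "{}" "\<lambda>_. 0"]) (use True r in auto)
      then show False using ncol by simp
    next
      case False
      then obtain w where w: "w \<in> W" by auto
      have "proper_colorable (r - 1)"
        by (rule proper_colorable_extend[OF bip W, of "{w}" "\<lambda>_. if \<exists>x\<in>X. E w x then 1 else 0"])
           (use w r one[OF w] small finW E_irrefl in \<open>auto simp: card_Diff_singleton\<close>)
      then show False using ncol by simp
    qed
  qed
  assume cW: "card W = r - 1"
  have key: False if w: "w \<in> W" "w' \<in> W" "w \<noteq> w'"
    and s: "i \<in> {0, 1}" "j \<in> {0, 1}" "i = (0::nat) \<longrightarrow> (\<forall>x\<in>X. \<not> E w x)" "i = 1 \<longrightarrow> (\<forall>y\<in>Y. \<not> E w y)"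
      "j = (0::nat) \<longrightarrow> (\<forall>x\<in>X. \<not> E w' x)" "j = 1 \<longrightarrow> (\<forall>y\<in>Y. \<not> E w' y)" "i \<noteq> j \<or> \<not> E w w'" for w w' i j
  proof -
    have "card (W - {w, w'}) = r - 3" using w cW finW by (simp add: card_Diff_insert card_Diff_subset)
    then have "proper_colorable (r - 1)"
      by (intro proper_colorable_extend[OF bip W, of "{w, w'}" "\<lambda>v. if v = w then i else j"])
         (use w s r E_irrefl E_sym in \<open>auto split: if_splits\<close>)
    then show False using ncol by simp
  qed
  let ?cX = "\<lambda>w. \<exists>x\<in>X. E w x" and ?cY = "\<lambda>w. \<exists>y\<in>Y. E w y"
  have type: "\<not> ?cX w \<or> \<not> ?cY w" if "w \<in> W" for w using one[OF that] by blast
  have opp: "?cX w \<or> ?cY w'" if "w \<in> W" "w' \<in> W" "w \<noteq> w'" for w w'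
    using key[OF that, of 0 1] by auto
  have other: "\<exists>w'\<in>W. w' \<noteq> w" for w
  proof -
    have "\<not> W \<subseteq> {w}" using card_mono[of "{w}" W] cW r by auto
    then show ?thesis by auto
  qed
  have adj: "E w w'" if "w \<in> W" "w' \<in> W" "w \<noteq> w'" for w w'
  proof (rule ccontr)
    assume nE: "\<not> E w w'"
    define side :: "'a \<Rightarrow> nat" where "side v = (if ?cX v then 1 else 0)" for v
    have side: "side v \<in> {0, 1}" "side v = 0 \<longrightarrow> (\<forall>x\<in>X. \<not> E v x)"
      "side v = 1 \<longrightarrow> (\<forall>y\<in>Y. \<not> E v y)" if "v \<in> W" for v
      using type[OF that] by (auto simp: side_def)
    show False
      by (rule key[OF that side(1)[OF that(1)] side(1)[OF that(2)] side(2,3)[OF that(1)] side(2,3)[OF that(2)]])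
        (use nE in simp)
  qed
  have "(\<forall>w\<in>W. ?cX w \<and> \<not> ?cY w) \<or> (\<forall>w\<in>W. ?cY w \<and> \<not> ?cX w)"
  proof (cases "\<exists>w\<in>W. \<not> ?cX w")
    case True
    then obtain w where w: "w \<in> W" "\<not> ?cX w" by blast
    have 1: "?cY w'" if "w' \<in> W" "w' \<noteq> w" for w' using opp[of w w'] w that by blast
    obtain w' where w': "w' \<in> W" "w' \<noteq> w" using other by blast
    then have "\<not> ?cX w'" using 1 type by blast
    then have "?cY w" using opp[of w' w] w w' by blast
    then have "?cY v" if "v \<in> W" for v using 1 that by (cases "v = w") auto
    then show ?thesis using type by blast
  next
    case False
    then show ?thesis using type by blast
  qed
  then show "(\<forall>w\<in>W. \<forall>w'\<in>W. w \<noteq> w' \<longrightarrow> E w w') \<and>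
      ((\<forall>w\<in>W. ?cX w \<and> (\<forall>y\<in>Y. \<not> E w y)) \<or> (\<forall>w\<in>W. ?cY w \<and> (\<forall>x\<in>X. \<not> E w x)))"
    using adj by blast
qed

text \<open>A path of length \<open>2l - 2\<close> from \<open>x\<close> to \<open>x'\<close> closes, through \<open>x', w', w, x\<close>, a cycle of length
\<open>2l + 1\<close>. For \<open>l = 2\<close> the path consists of one common neighbour, whose existence needs the stronger
hypothesis that \<open>x\<close> and \<open>x'\<close> each miss less than half of \<open>Y\<close>.\<close>

lemma unique_attachment:
  assumes free: "cycle_lists E V (2 * l + 1) = {}" and l2: "l \<ge> 2"
    and nc: "near_complete m D X1 Y1" and D: "m + 2 * l + 6 \<le> D"
    and X: "X = well_attached D Y1" and Y: "Y \<subseteq> V" "Y \<inter> W = {}" "X \<inter> W = {}"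
    and miss: "\<And>x. x \<in> X \<Longrightarrow> 2 * card (Y - nbrs x) < card Y"
    and w: "w \<in> W" "w' \<in> W" "E w w'" "x \<in> X" "x' \<in> X" "E w x" "E w' x'"
  shows "x = x'"
proof (rule ccontr)
  assume ne: "x \<noteq> x'"
  have wx: "x \<notin> {w, w'}" "x' \<notin> {w, w'}" "w \<noteq> w'" using w Y E_irrefl by auto
  have "path_avoiding {w', w} (2 * l - 2) x x'"
  proof (cases "l = 2")
    case True
    have finY: "finite Y" using finite_subset[OF Y(1) finV] .
    have "card ((Y - nbrs x) \<union> (Y - nbrs x')) < card Y"
      using miss[OF w(4)] miss[OF w(5)] card_Un_le[of "Y - nbrs x" "Y - nbrs x'"] by linarith
    from ex_notin[OF _ this] finY obtain y where y: "y \<in> Y" "E x y" "E x' y" by auto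
    then have "y \<noteq> x" "y \<noteq> x'" "y \<noteq> w" "y \<noteq> w'" using E_irrefl w Y by auto
    then show ?thesis using True y wx ne E_sym
      by (auto simp: path_avoiding_def intro!: exI[of _ "[x, y, x']"])
  next
    case False
    then have l: "2 * l - 2 = 2 * (l - 3) + 4" using l2 by simp
    show ?thesis unfolding l
      by (rule path_avoiding_even[OF nc]) (use wx w ne D False l2 X in \<open>auto simp: well_attached_def card_insert_if\<close>)
  qed
  then have "path_avoiding {w'} (Suc (2 * l - 2)) w x'"
    using path_avoiding_Cons[OF w(6), of "{w'}"] wx by (simp add: insert_commute)
  then have "path_avoiding {} (Suc (Suc (2 * l - 2))) w' x'" using path_avoiding_Cons[OF E_sym[OF w(3)], of "{}"] by simp
  moreover have "Suc (Suc (Suc (2 * l - 2))) = 2 * l + 1" using l2 by simp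
  ultimately show False using path_avoiding_close[of "{}" _ w' x'] w(7) E_sym free by metis
qed

end

section \<open>Gluing a clique to a bipartite graph\<close>

lemma card_distinct_lists:
  assumes "finite A"
  shows "card {xs. length xs = k \<and> distinct xs \<and> set xs \<subseteq> A} = falling (card A) k"
proof (induction k)
  case 0
  have "{xs. length xs = 0 \<and> distinct xs \<and> set xs \<subseteq> A} = {[]}" by auto
  then show ?case by simp
next
  case (Suc k)
  let ?L = "\<lambda>k. {xs. length xs = k \<and> distinct xs \<and> set xs \<subseteq> A}"
  have fin: "finite (?L k)"
    by (rule finite_subset[OF _ finite_lists_length_eq[OF assms, of k]]) auto
  have "?L (Suc k) = (\<lambda>(xs, x). x # xs) ` Sigma (?L k) (\<lambda>xs. A - set xs)"
    by (auto simp: length_Suc_conv image_iff)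
  moreover have "inj_on (\<lambda>(xs, x). x # xs) (Sigma (?L k) (\<lambda>xs. A - set xs))"
    by (auto simp: inj_on_def)
  ultimately have "card (?L (Suc k)) = card (Sigma (?L k) (\<lambda>xs. A - set xs))"
    by (simp add: card_image)
  also have "\<dots> = (\<Sum>xs\<in>?L k. card (A - set xs))" using fin assms by simp
  also have "\<dots> = (\<Sum>xs\<in>?L k. card A - k)"
    by (intro sum.cong refl) (auto simp: card_Diff_subset distinct_card)
  also have "\<dots> = falling (card A) (Suc k)" using Suc by (simp add: falling_Suc)
  finally show ?case .
qed

lemma clique_successively:
  assumes "\<And>u v. u \<in> A \<Longrightarrow> v \<in> A \<Longrightarrow> u \<noteq> v \<Longrightarrow> R u v"
  shows "distinct vs \<Longrightarrow> set vs \<subseteq> A \<Longrightarrow> successively R vs"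
  by (induction vs rule: induct_list012) (use assms in auto)

context fin_graph begin

lemma card_cycle_lists_le:
  assumes "finite A" shows "card (cycle_lists E A k) \<le> falling (card A) k"
  unfolding card_distinct_lists[OF assms, symmetric]
  by (intro card_mono finite_subset[OF _ finite_lists_length_eq[OF assms, of k]])
     (auto simp: cycle_lists_def cyclic_def)

lemma card_cycle_lists_clique:
  assumes "finite A" "\<And>u v. u \<in> A \<Longrightarrow> v \<in> A \<Longrightarrow> u \<noteq> v \<Longrightarrow> E u v" "k \<ge> 2"
  shows "card (cycle_lists E A k) = falling (card A) k"
proof -
  have "cyclic E vs" if len: "length vs = k" and "distinct vs" "set vs \<subseteq> A" for vs
  proof -
    obtain u v ws where vs: "vs = u # v # ws"
      using len assms(3) by (cases vs; cases "tl vs") auto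
    then have "last vs \<noteq> hd vs" "last vs \<in> set vs" "hd vs \<in> set vs" using that(2) by auto
    then have "E (last vs) (hd vs)" using assms(2) that(3) by blast
    then show ?thesis using clique_successively[OF assms(2)] that by (auto simp: cyclic_def)
  qed
  then have "cycle_lists E A k = {xs. length xs = k \<and> distinct xs \<and> set xs \<subseteq> A}"
    by (auto simp: cycle_lists_def cyclic_def)
  then show ?thesis using card_distinct_lists[OF assms(1)] by simp
qed

text \<open>The outside part \<open>W\<close> is separated from the bipartite part by the single vertex \<open>x0\<close>.\<close>

definition glued :: "'a set \<Rightarrow> 'a set \<Rightarrow> 'a set \<Rightarrow> 'a \<Rightarrow> bool" where
  "glued X Y W x0 \<longleftrightarrow> bipartition X Y \<and> W = V - (X \<union> Y) \<and> x0 \<in> X \<union> Y \<and>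
     (\<forall>u v. E u v \<longrightarrow> u \<in> W \<longrightarrow> v \<in> insert x0 W)"

lemma glued_sym: "glued X Y W x0 \<Longrightarrow> glued Y X W x0"
  by (auto simp: glued_def intro: bipartition_sym)

lemma successively_one_side:
  assumes "successively E vs" "set vs \<subseteq> A \<union> B"
    "\<And>u v. E u v \<Longrightarrow> \<not> (u \<in> A \<and> v \<in> B) \<and> \<not> (u \<in> B \<and> v \<in> A)"
  shows "set vs \<subseteq> A \<or> set vs \<subseteq> B"
  using assms(1,2)
proof (induction vs)
  case (Cons v vs)
  show ?case
  proof (cases vs)
    case (Cons w ws)
    then show ?thesis using Cons.prems Cons.IH assms(3)[of v w] by auto
  qed (use Cons.prems in auto)
qed simp

text \<open>Rotating a cyclic list so that the cut vertex comes first leaves a path that avoids it, and a path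
without the cut vertex stays on one side.\<close>

lemma cycle_lists_glued:
  assumes "glued X Y W x0"
  shows "cycle_lists E V t = cycle_lists E (X \<union> Y) t \<union> cycle_lists E (insert x0 W) t"
proof (intro set_eqI iffI)
  fix vs assume "vs \<in> cycle_lists E V t"
  then have vs: "length vs = t" "set vs \<subseteq> V" "cyclic E vs" by (auto simp: cycle_lists_def)
  let ?A = "X \<union> Y - {x0}"
  \<comment> \<open>the two sides that remain after removing the cut vertex\<close>
  have V: "V = insert x0 (?A \<union> W)" and W: "W = V - (X \<union> Y)"
    and out: "\<And>u v. E u v \<Longrightarrow> u \<in> W \<Longrightarrow> v \<in> insert x0 W"
    using assms by (auto simp: glued_def bipartition_def)
  have sep: "\<not> (u \<in> ?A \<and> v \<in> W) \<and> \<not> (u \<in> W \<and> v \<in> ?A)" if "E u v" for u v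
    using out[OF that] out[OF E_sym[OF that]] W by blast
  have "set vs \<subseteq> insert x0 ?A \<or> set vs \<subseteq> insert x0 W"
  proof (cases "x0 \<in> set vs")
    case False
    then have "set vs \<subseteq> ?A \<union> W" using vs(2) V by auto
    moreover have "successively E vs" using vs(3) by (simp add: cyclic_def)
    ultimately have "set vs \<subseteq> ?A \<or> set vs \<subseteq> W" using sep by (intro successively_one_side)
    then show ?thesis by blast
  next
    case True
    then obtain ps qs where s: "vs = ps @ x0 # qs" by (auto simp: in_set_conv_decomp)
    have "successively E (qs @ ps)"
      using vs(3) s by (cases "ps = []"; cases "qs = []")
        (auto simp: cyclic_def successively_append_iff successively_Cons split: if_splits)
    moreover have "set (qs @ ps) \<subseteq> ?A \<union> W" using vs(2,3) V s by (auto simp: cyclic_def)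
    ultimately have "set (qs @ ps) \<subseteq> ?A \<or> set (qs @ ps) \<subseteq> W" using sep by (intro successively_one_side)
    then show ?thesis using s by auto
  qed
  moreover have "insert x0 ?A = X \<union> Y" using assms by (auto simp: glued_def)
  ultimately show "vs \<in> cycle_lists E (X \<union> Y) t \<union> cycle_lists E (insert x0 W) t"
    using vs by (auto simp: cycle_lists_def)
next
  fix vs assume "vs \<in> cycle_lists E (X \<union> Y) t \<union> cycle_lists E (insert x0 W) t"
  then show "vs \<in> cycle_lists E V t" using assms by (auto simp: cycle_lists_def glued_def bipartition_def)
qed

lemma card_cycle_lists_glued:
  assumes "glued X Y W x0" "t \<ge> 2"
  shows "card (cycle_lists E V t) = card (cycle_lists E (X \<union> Y) t) + card (cycle_lists E (insert x0 W) t)"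
proof -
  have sub: "X \<union> Y \<subseteq> V" "insert x0 W \<subseteq> V" using assms by (auto simp: glued_def bipartition_def)
  have "False" if "vs \<in> cycle_lists E (X \<union> Y) t" "vs \<in> cycle_lists E (insert x0 W) t" for vs
  proof -
    have "set vs \<subseteq> {x0}" using that assms(1) by (auto simp: cycle_lists_def glued_def)
    then have "card (set vs) \<le> 1" using card_mono[of "{x0}"] by fastforce
    then show False using that assms(2) by (auto simp: cycle_lists_def cyclic_def distinct_card)
  qed
  then show ?thesis
    unfolding cycle_lists_glued[OF assms(1)] using finite_cycle_lists sub by (intro card_Un_disjoint) auto
qed

lemma glued_cards:
  assumes "glued X Y W x0"
  shows "card V = card X + card Y + card W" "card (insert x0 W) = Suc (card W)" "finite X" "finite Y" "finite W"
proof -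
  have fin: "finite X" "finite Y" "finite W" using assms finV finite_subset
    by (auto simp: glued_def bipartition_def)
  show "finite X" "finite Y" "finite W" by fact+
  have d: "X \<inter> Y = {}" "(X \<union> Y) \<inter> W = {}" "V = (X \<union> Y) \<union> W" "x0 \<notin> W"
    using assms by (auto simp: glued_def bipartition_def)
  show "card V = card X + card Y + card W"
    unfolding d(3) using fin card_Un_disjoint[OF _ fin(3) d(2)] card_Un_disjoint[OF fin(1,2) d(1)] by simp
  show "card (insert x0 W) = Suc (card W)" using fin d by simp
qed

text \<open>The two blocks are bounded separately: the bipartite one by the balanced complete bipartite graph, the
other one by the clique. Equality in the sum forces equality throughout.\<close>

lemma glued_upper_bound:
  assumes g: "glued X Y W x0" and a: "a \<ge> 2" "a \<le> card X" "a \<le> card Y"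
  defines "m \<equiv> card X + card Y"
  shows "card (cycle_lists E V (2 * a)) \<le> balanced_count a m + falling (Suc (card W)) (2 * a)"
    "card (cycle_lists E V (2 * a)) = balanced_count a m + falling (Suc (card W)) (2 * a) \<Longrightarrow>
       (\<forall>x\<in>X. \<forall>y\<in>Y. E x y) \<and> (card X = m div 2 \<or> card Y = m div 2)"
proof -
  have bip: "bipartition X Y" using g by (simp add: glued_def)
  have a1: "a \<ge> 1" using a by simp
  note c = glued_cards[OF g]
  have 1: "card (cycle_lists E V (2 * a)) = card (cycle_lists E (X \<union> Y) (2 * a)) + card (cycle_lists E (insert x0 W) (2 * a))"
    using card_cycle_lists_glued[OF g] a by simp
  have 2: "card (cycle_lists E (insert x0 W) (2 * a)) \<le> falling (Suc (card W)) (2 * a)"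
    using card_cycle_lists_le[of "insert x0 W"] c by simp
  have 3: "card (cycle_lists E (X \<union> Y) (2 * a)) \<le> 2 * falling (card X) a * falling (card Y) a"
    using card_cycle_lists_bipartition_le[OF bip a1] .
  have 4: "2 * falling (card X) a * falling (card Y) a \<le> balanced_count a m"
    unfolding m_def using falling_prod_balanced_count[OF a1] .
  show "card (cycle_lists E V (2 * a)) \<le> balanced_count a m + falling (Suc (card W)) (2 * a)"
    using 1 2 3 4 by linarith
  assume "card (cycle_lists E V (2 * a)) = balanced_count a m + falling (Suc (card W)) (2 * a)"
  then have eq: "card (cycle_lists E (X \<union> Y) (2 * a)) = 2 * falling (card X) a * falling (card Y) a"
      "2 * falling (card X) a * falling (card Y) a = balanced_count a m"
    using 1 2 3 4 by linarith+
  have "E x y" if "x \<in> X" "y \<in> Y" for x y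
  proof -
    have "card (Y - nbrs x) * (falling (card X - 1) (a - 1) * falling (card Y - 1) (a - 1)) = 0"
      using card_cycle_lists_bipartition[OF bip that(1) a1] eq(1) by linarith
    moreover have "falling (card X - 1) (a - 1) > 0" "falling (card Y - 1) (a - 1) > 0"
      using a by (auto intro!: falling_pos)
    ultimately have "Y - nbrs x = {}" using c by auto
    then show ?thesis using that by auto
  qed
  then show "(\<forall>x\<in>X. \<forall>y\<in>Y. E x y) \<and> (card X = m div 2 \<or> card Y = m div 2)"
    using falling_prod_balanced_count_eq[OF a1 a(2,3)] eq(2) by (auto simp: m_def)
qed

end

text \<open>An intrinsic description of the members of the family, with their parts named; here \<open>m = n - r + 1\<close>.\<close>

definition Tstar_shape :: "nat \<Rightarrow> nat \<Rightarrow> 'a graph \<Rightarrow> 'a set \<Rightarrow> 'a set \<Rightarrow> 'a set \<Rightarrow> 'a \<Rightarrow> bool" where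
  "Tstar_shape r m G X Y W x0 \<longleftrightarrow> simple_graph G \<and> verts G = X \<union> Y \<union> W \<and>
     X \<inter> Y = {} \<and> X \<inter> W = {} \<and> Y \<inter> W = {} \<and> x0 \<in> X \<union> Y \<and>
     card X = m div 2 \<and> card Y = m - m div 2 \<and> card W = r - 1 \<and>
     (\<forall>u v. adj G u v \<longleftrightarrow> u \<noteq> v \<and>
        (u \<in> X \<and> v \<in> Y \<or> u \<in> Y \<and> v \<in> X \<or> u \<in> insert x0 W \<and> v \<in> insert x0 W))"

lemma edge_image_iff:
  assumes "simple_graph F" "inj_on f (verts F)" "u \<in> verts F" "v \<in> verts F"
  shows "{f u, f v} \<in> (`) f ` edges F \<longleftrightarrow> adj F u v"
proof
  assume "{f u, f v} \<in> (`) f ` edges F"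
  then obtain e where e: "e \<in> edges F" "f ` e = f ` {u, v}" by auto
  then have "e = {u, v}"
    using inj_on_image_eq_iff[OF assms(2), of e "{u, v}"] assms by (auto simp: simple_graph_def)
  then show "adj F u v" using e by (simp add: adj_def)
next
  assume "adj F u v"
  then show "{f u, f v} \<in> (`) f ` edges F"
    by (auto simp: adj_def intro!: image_eqI[of _ _ "{u, v}"])
qed

lemma edge_obtain:
  assumes "simple_graph G" "e \<in> edges G"
  obtains u v where "e = {u, v}" "adj G u v" "u \<in> verts G" "v \<in> verts G"
proof -
  obtain u v where "e = {u, v}" using assms by (auto simp: simple_graph_def card_2_iff)
  then show ?thesis using that assms by (auto simp: adj_def simple_graph_def)
qed

lemma isomorphicI:
  assumes "simple_graph F" "simple_graph G" "bij_betw f (verts F) (verts G)"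
    "\<And>u v. u \<in> verts F \<Longrightarrow> v \<in> verts F \<Longrightarrow> adj F u v \<longleftrightarrow> adj G (f u) (f v)"
  shows "isomorphic F G"
  unfolding isomorphic_def
proof (intro exI conjI)
  show "(`) f ` edges F = edges G"
  proof (intro set_eqI iffI)
    fix e assume "e \<in> (`) f ` edges F"
    then obtain d where d: "d \<in> edges F" "e = f ` d" by auto
    then show "e \<in> edges G" using edge_obtain[OF assms(1) d(1)] assms(4) by (force simp: adj_def)
  next
    fix e assume "e \<in> edges G"
    then obtain u v where e: "e = {u, v}" "adj G u v" "u \<in> verts G" "v \<in> verts G"
      using edge_obtain[OF assms(2)] by blast
    then have "u \<in> f ` verts F" "v \<in> f ` verts F" using assms(3) by (auto simp: bij_betw_def)
    then obtain u' v' where "u = f u'" "v = f v'" "u' \<in> verts F" "v' \<in> verts F" by blast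
    then have "{u', v'} \<in> edges F" "e = f ` {u', v'}" using assms(4) e by (auto simp: adj_def)
    then show "e \<in> (`) f ` edges F" by blast
  qed
qed (rule assms(3))

lemma Tstar_shape_isomorphic:
  assumes T: "Tstar_shape r m F X Y W x0" and "isomorphic F G" and G: "simple_graph G"
  shows "\<exists>X Y W x0. Tstar_shape r m G X Y W x0"
proof -
  obtain f where f: "bij_betw f (verts F) (verts G)" "(`) f ` edges F = edges G"
    using assms(2) by (auto simp: isomorphic_def)
  have F: "simple_graph F" and VF: "verts F = X \<union> Y \<union> W" using T by (auto simp: Tstar_shape_def)
  have inj: "inj_on f (verts F)" using f by (simp add: bij_betw_def)
  have adjf: "adj G (f u) (f v) \<longleftrightarrow> adj F u v" if "u \<in> verts F" "v \<in> verts F" for u v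
    using edge_image_iff[OF F inj that] f(2) by (simp add: adj_def)
  have mem: "f u \<in> f ` A \<longleftrightarrow> u \<in> A" if "u \<in> verts F" "A \<subseteq> verts F" for u A
    using inj_on_image_mem_iff[OF inj that] .
  have x0: "x0 \<in> verts F" using T by (auto simp: Tstar_shape_def)
  have img: "verts G = f ` verts F" using f by (auto simp: bij_betw_def)
  have card: "card (f ` A) = card A" if "A \<subseteq> verts F" for A
    using card_image inj that inj_on_subset by blast
  have disj: "f ` A \<inter> f ` B = {}" if "A \<inter> B = {}" "A \<subseteq> verts F" "B \<subseteq> verts F" for A B
    using that inj_on_image_Int[OF inj that(2,3)] by simp
  have adjG: "adj G u v \<longleftrightarrow> u \<noteq> v \<and> (u \<in> f ` X \<and> v \<in> f ` Y \<or> u \<in> f ` Y \<and> v \<in> f ` X \<or>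
      u \<in> insert (f x0) (f ` W) \<and> v \<in> insert (f x0) (f ` W))" (is "_ \<longleftrightarrow> ?R u v") for u v
  proof (cases "u \<in> verts G \<and> v \<in> verts G")
    case True
    then obtain p q where pq: "u = f p" "v = f q" "p \<in> verts F" "q \<in> verts F" unfolding img by auto
    have "adj F p q \<longleftrightarrow> p \<noteq> q \<and>
        (p \<in> X \<and> q \<in> Y \<or> p \<in> Y \<and> q \<in> X \<or> p \<in> insert x0 W \<and> q \<in> insert x0 W)"
      using T unfolding Tstar_shape_def by blast
    moreover have "f p = f q \<longleftrightarrow> p = q" "f p = f x0 \<longleftrightarrow> p = x0" "f q = f x0 \<longleftrightarrow> q = x0"
      using inj pq x0 by (auto simp: inj_on_def)
    moreover have "f p \<in> f ` A \<longleftrightarrow> p \<in> A" "f q \<in> f ` A \<longleftrightarrow> q \<in> A" if "A \<in> {X, Y, W}" for A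
      using mem pq(3,4) that VF by auto
    ultimately show ?thesis unfolding pq adjf[OF pq(3,4)] by auto
  next
    case False
    have "\<not> adj G u v" using False G fin_graph.E_in[OF fin_graph_adj[OF G]] fin_graph.E_sym[OF fin_graph_adj[OF G]] by blast
    moreover have "\<not> ?R u v" using False x0 unfolding img VF by auto
    ultimately show ?thesis by simp
  qed
  have "Tstar_shape r m G (f ` X) (f ` Y) (f ` W) (f x0)"
    unfolding Tstar_shape_def
  proof (intro conjI allI adjG G)
    show "verts G = f ` X \<union> f ` Y \<union> f ` W" using img VF by auto
    show "f ` X \<inter> f ` Y = {}" "f ` X \<inter> f ` W = {}" "f ` Y \<inter> f ` W = {}"
      using T VF by (intro disj; simp add: Tstar_shape_def; blast)+
    show "f x0 \<in> f ` X \<union> f ` Y" using T by (auto simp: Tstar_shape_def)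
    show "card (f ` X) = m div 2" "card (f ` Y) = m - m div 2" "card (f ` W) = r - 1"
      using T card[of X] card[of Y] card[of W] VF by (auto simp: Tstar_shape_def)
  qed
  then show ?thesis by blast
qed

lemma bij_betw_pointed:
  assumes "finite A" "finite B" "card A = card B"
  shows "\<exists>f. bij_betw f A B \<and> (a \<in> A \<and> b \<in> B \<longrightarrow> f a = b)"
proof (cases "a \<in> A \<and> b \<in> B")
  case True
  have "card (A - {a}) = card (B - {b})" using assms True by simp
  then obtain g where g: "bij_betw g (A - {a}) (B - {b})"
    using assms finite_same_card_bij[of "A - {a}" "B - {b}"] by auto
  have "bij_betw (g(a := b)) (insert a (A - {a})) (insert b (B - {b}))"
    unfolding bij_betw_def
  proof
    have gi: "inj_on g (A - {a})" "g ` (A - {a}) = B - {b}" using g by (auto simp: bij_betw_def)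
    show "inj_on (g(a := b)) (insert a (A - {a}))"
      using gi by (auto simp: inj_on_def)
    show "(g(a := b)) ` insert a (A - {a}) = insert b (B - {b})"
      using gi(2) by auto
  qed
  then show ?thesis using True by (intro exI[of _ "g(a := b)"]) (simp add: insert_absorb)
next
  case False
  then show ?thesis using finite_same_card_bij[OF assms] by auto
qed

text \<open>Up to isomorphism only the side containing the gluing vertex matters, since all vertices of one side of a
complete bipartite graph are alike.\<close>

lemma Tstar_shape_unique:
  assumes F: "Tstar_shape r m F X Y W x" and G: "Tstar_shape r m G X' Y' W' x'" and side: "x \<in> X \<longleftrightarrow> x' \<in> X'"
  shows "isomorphic F G"
proof -
  have fin: "finite X" "finite Y" "finite W" "finite X'" "finite Y'" "finite W'"
    using F G by (auto simp: Tstar_shape_def simple_graph_def)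
  obtain fX where fX: "bij_betw fX X X'" "x \<in> X \<and> x' \<in> X' \<longrightarrow> fX x = x'"
    using bij_betw_pointed[of X X' x x'] fin F G by (auto simp: Tstar_shape_def)
  obtain fY where fY: "bij_betw fY Y Y'" "x \<in> Y \<and> x' \<in> Y' \<longrightarrow> fY x = x'"
    using bij_betw_pointed[of Y Y' x x'] fin F G by (auto simp: Tstar_shape_def)
  obtain fW where fW: "bij_betw fW W W'"
    using finite_same_card_bij[of W W'] fin F G by (auto simp: Tstar_shape_def)
  define f where "f v = (if v \<in> X then fX v else if v \<in> Y then fY v else fW v)" for v
  have d: "X \<inter> Y = {}" "X \<inter> W = {}" "Y \<inter> W = {}" "X' \<inter> Y' = {}" "X' \<inter> W' = {}" "Y' \<inter> W' = {}"
    "x \<in> X \<union> Y" "x' \<in> X' \<union> Y'" "verts F = X \<union> Y \<union> W" "verts G = X' \<union> Y' \<union> W'"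
    using F G by (auto simp: Tstar_shape_def)
  have bX: "bij_betw f X X'" using fX by (subst bij_betw_cong[of X f fX]) (auto simp: f_def)
  have bY: "bij_betw f Y Y'" using fY d by (subst bij_betw_cong[of Y f fY]) (auto simp: f_def)
  have bW: "bij_betw f W W'" using fW d by (subst bij_betw_cong[of W f fW]) (auto simp: f_def)
  have bij: "bij_betw f (verts F) (verts G)"
    unfolding d(9,10) using d by (intro bij_betw_combine bX bY bW) auto
  have fx: "f x = x'" using fX(2) fY(2) d side by (auto simp: f_def)
  have xF: "x \<in> verts F" using d by auto
  have inj: "inj_on f (verts F)" using bij by (simp add: bij_betw_def)
  have memb: "f v \<in> X' \<longleftrightarrow> v \<in> X" "f v \<in> Y' \<longleftrightarrow> v \<in> Y" "f v \<in> W' \<longleftrightarrow> v \<in> W" if "v \<in> verts F" for v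
  proof -
    have "v \<in> X \<Longrightarrow> f v \<in> X'" "v \<in> Y \<Longrightarrow> f v \<in> Y'" "v \<in> W \<Longrightarrow> f v \<in> W'"
      using bij_betwE[OF bX] bij_betwE[OF bY] bij_betwE[OF bW] by auto
    moreover have "v \<in> X \<or> v \<in> Y \<or> v \<in> W" using that d(9) by auto
    ultimately show "f v \<in> X' \<longleftrightarrow> v \<in> X" "f v \<in> Y' \<longleftrightarrow> v \<in> Y" "f v \<in> W' \<longleftrightarrow> v \<in> W"
      using d(1-6) by blast+
  qed
  show ?thesis
  proof (rule isomorphicI[OF _ _ bij])
    fix u v assume uv: "u \<in> verts F" "v \<in> verts F"
    have "f u = f v \<longleftrightarrow> u = v" "f u = x' \<longleftrightarrow> u = x" "f v = x' \<longleftrightarrow> v = x"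
      using inj uv xF fx by (auto simp: inj_on_def)
    moreover have "adj F u v \<longleftrightarrow> u \<noteq> v \<and>
        (u \<in> X \<and> v \<in> Y \<or> u \<in> Y \<and> v \<in> X \<or> u \<in> insert x W \<and> v \<in> insert x W)"
      using F unfolding Tstar_shape_def by blast
    moreover have "adj G (f u) (f v) \<longleftrightarrow> f u \<noteq> f v \<and>
        (f u \<in> X' \<and> f v \<in> Y' \<or> f u \<in> Y' \<and> f v \<in> X' \<or> f u \<in> insert x' W' \<and> f v \<in> insert x' W')"
      using G unfolding Tstar_shape_def by blast
    ultimately show "adj F u v \<longleftrightarrow> adj G (f u) (f v)" using memb uv by auto
  qed (use F G in \<open>auto simp: Tstar_shape_def\<close>)
qed

lemma image_edge_iff:
  assumes "simple_graph G"
  shows "{p, q} \<in> (`) g ` edges G \<longleftrightarrow> (\<exists>i j. p = g i \<and> q = g j \<and> adj G i j)"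
proof
  assume "{p, q} \<in> (`) g ` edges G"
  then obtain e where e: "e \<in> edges G" "{p, q} = g ` e" by auto
  obtain i j where "e = {i, j}" "adj G i j" using edge_obtain[OF assms e(1)] by blast
  then have "{p, q} = {g i, g j}" "adj G i j" "adj G j i"
    using e(2) fin_graph.E_sym[OF fin_graph_adj[OF assms]] by auto
  then show "\<exists>i j. p = g i \<and> q = g j \<and> adj G i j" by (auto simp: doubleton_eq_iff)
next
  assume "\<exists>i j. p = g i \<and> q = g j \<and> adj G i j"
  then obtain i j where "p = g i" "q = g j" "{i, j} \<in> edges G" by (auto simp: adj_def)
  then show "{p, q} \<in> (`) g ` edges G" by (auto intro!: image_eqI[of _ _ "{i, j}"])
qed

lemma turan2_facts:
  "simple_graph (turan2 m)" "verts (turan2 m) = {..<m}"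
  "adj (turan2 m) i j \<longleftrightarrow> (i < m div 2 \<and> m div 2 \<le> j \<and> j < m) \<or> (j < m div 2 \<and> m div 2 \<le> i \<and> i < m)"
  by (auto simp: simple_graph_def turan2_def adj_def card_insert_if doubleton_eq_iff)

lemma complete_graph_facts:
  "simple_graph (complete_graph r)" "verts (complete_graph r) = {..<r}"
  "adj (complete_graph r) i j \<longleftrightarrow> i < r \<and> j < r \<and> i \<noteq> j"
  by (auto simp: simple_graph_def complete_graph_def adj_def card_insert_if doubleton_eq_iff)

lemma Tstar_shape_suspend:
  assumes "x < m" "y < r"
  shows "Tstar_shape r m (suspend (complete_graph r) y (turan2 m) x)
    (Inl ` {..<m div 2}) (Inl ` {m div 2..<m}) (Inr ` ({..<r} - {y})) (Inl x)"
proof -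
  define g where "g h = (if h = y then Inl x else Inr h)" for h :: nat
  let ?S = "suspend (complete_graph r) y (turan2 m) x"
  have eq: "verts ?S = Inl ` {..<m} \<union> g ` {..<r}"
    "edges ?S = (`) Inl ` edges (turan2 m) \<union> (`) g ` edges (complete_graph r)"
    by (simp_all add: suspend_def Let_def turan2_facts complete_graph_facts g_def[abs_def])
  have adjS: "adj ?S p q \<longleftrightarrow> (\<exists>i j. p = Inl i \<and> q = Inl j \<and> adj (turan2 m) i j) \<or>
      (\<exists>i j. p = g i \<and> q = g j \<and> adj (complete_graph r) i j)" for p q
    unfolding adj_def[of ?S] eq(2) Un_iff image_edge_iff[OF turan2_facts(1)]
      image_edge_iff[OF complete_graph_facts(1)] ..
  have ginj: "g i = g j \<longleftrightarrow> i = j" for i j by (auto simp: g_def)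
  have gimg: "g ` {..<r} = insert (Inl x) (Inr ` ({..<r} - {y}))" using assms by (auto simp: g_def)
  have clique: "(\<exists>i j. p = g i \<and> q = g j \<and> adj (complete_graph r) i j) \<longleftrightarrow>
      p \<noteq> q \<and> p \<in> insert (Inl x) (Inr ` ({..<r} - {y})) \<and> q \<in> insert (Inl x) (Inr ` ({..<r} - {y}))" for p q
    unfolding gimg[symmetric] complete_graph_facts by (auto simp: ginj)
  have adjS': "adj ?S p q \<longleftrightarrow> p \<noteq> q \<and> (p \<in> Inl ` {..<m div 2} \<and> q \<in> Inl ` {m div 2..<m} \<or>
     p \<in> Inl ` {m div 2..<m} \<and> q \<in> Inl ` {..<m div 2} \<or>
     p \<in> insert (Inl x) (Inr ` ({..<r} - {y})) \<and> q \<in> insert (Inl x) (Inr ` ({..<r} - {y})))" for p q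
    unfolding adjS clique turan2_facts by (auto simp: image_iff)
  have split: "{..<m} = {..<m div 2} \<union> {m div 2..<m}" by auto
  have vS: "verts ?S = Inl ` {..<m div 2} \<union> Inl ` {m div 2..<m} \<union> Inr ` ({..<r} - {y})"
    unfolding eq gimg split using assms(1) by (auto simp: image_iff)
  have xS: "Inl x \<in> verts ?S" unfolding eq using assms(1) by auto
  have "simple_graph ?S"
    unfolding simple_graph_def
  proof
    show "finite (verts ?S)" unfolding vS by simp
    show "edges ?S \<subseteq> {e. e \<subseteq> verts ?S \<and> card e = 2}"
    proof
      fix e assume e: "e \<in> edges ?S"
      then obtain d h where d: "e = h ` d" "d \<in> edges (turan2 m) \<and> h = Inl \<or> d \<in> edges (complete_graph r) \<and> h = g"
        unfolding eq by auto
      then obtain i j where ij: "d = {i, j}"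
        using edge_obtain[OF turan2_facts(1)] edge_obtain[OF complete_graph_facts(1)] by metis
      then have e2: "e = {h i, h j}" using d by simp
      then have "adj ?S (h i) (h j)" using e by (simp add: adj_def)
      then have "h i \<noteq> h j" "h i \<in> verts ?S" "h j \<in> verts ?S" using xS unfolding adjS' vS by auto
      then show "e \<in> {e. e \<subseteq> verts ?S \<and> card e = 2}" using e2 by simp
    qed
  qed
  then show ?thesis
    unfolding Tstar_shape_def
  proof (intro conjI allI adjS' vS)
    show "Inl x \<in> (Inl ` {..<m div 2} \<union> Inl ` {m div 2..<m} :: (nat + nat) set)"
      using assms(1) by (auto simp: image_iff)
    show "card (Inr ` ({..<r} - {y}) :: (nat + nat) set) = r - 1"
      using assms(2) by (subst card_image) auto
  qed (auto simp: card_image)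
qed

lemma Tstar_iff:
  assumes "r \<ge> 1" "n + 1 - r \<ge> 2"
  shows "G \<in> Tstar r n \<longleftrightarrow> (\<exists>X Y W x0. Tstar_shape r (n + 1 - r) G X Y W x0)"
proof
  assume "G \<in> Tstar r n"
  then obtain x y where "simple_graph G" "x < n + 1 - r" "y < r"
    "isomorphic (suspend (complete_graph r) y (turan2 (n + 1 - r)) x) G"
    by (auto simp: Tstar_def turan2_facts complete_graph_facts)
  then show "\<exists>X Y W x0. Tstar_shape r (n + 1 - r) G X Y W x0"
    using Tstar_shape_isomorphic[OF Tstar_shape_suspend] by blast
next
  let ?m = "n + 1 - r"
  assume "\<exists>X Y W x0. Tstar_shape r ?m G X Y W x0"
  then obtain X Y W x0 where T: "Tstar_shape r ?m G X Y W x0" by blast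
  \<comment> \<open>only the side of the gluing vertex matters; 0 and \<open>?m div 2\<close> are the least vertices of the two sides\<close>
  define x where "x = (if x0 \<in> X then 0 else ?m div 2)"
  have "?m div 2 < ?m" "0 < ?m div 2" using assms by auto
  then have x: "x < ?m" "((Inl x :: nat + nat) \<in> Inl ` {..<?m div 2}) = (x0 \<in> X)" by (auto simp: x_def)
  have r: "0 < r" using assms by simp
  have "isomorphic (suspend (complete_graph r) 0 (turan2 ?m) x) G"
    by (rule Tstar_shape_unique[OF Tstar_shape_suspend[OF x(1) r] T x(2)])
  moreover have "x \<in> verts (turan2 ?m)" "0 \<in> verts (complete_graph r)"
    using x(1) r by (simp_all add: turan2_facts complete_graph_facts)
  moreover have "simple_graph G" using T by (simp add: Tstar_shape_def)
  ultimately show "G \<in> Tstar r n" unfolding Tstar_def by blast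
qed

text \<open>A member of the family is needed to see that the upper bound is attained.\<close>

lemma Tstar_shape_exists:
  assumes "m \<ge> 2" "r \<ge> 1"
  shows "\<exists>(G :: nat graph) X Y W x0. Tstar_shape r m G X Y W x0"
proof -
  have m: "0 < m div 2" "m div 2 < m" using assms by auto
  define X Y W where "X = {..<m div 2}" and "Y = {m div 2..<m}" and "W = {m..<m + r - 1}"
  define R where "R u v \<longleftrightarrow> u \<noteq> v \<and> (u \<in> X \<and> v \<in> Y \<or> u \<in> Y \<and> v \<in> X \<or> u \<in> insert 0 W \<and> v \<in> insert 0 W)" for u v
  define G where "G = \<lparr>verts = X \<union> Y \<union> W, edges = {{u, v} | u v. R u v}\<rparr>"
  have symR: "R u v \<Longrightarrow> R v u" for u v by (auto simp: R_def)
  have adjG: "adj G u v \<longleftrightarrow> R u v" for u v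
    using symR by (auto simp: G_def adj_def doubleton_eq_iff)
  have "simple_graph G" using m(1)
    by (auto simp: simple_graph_def G_def R_def X_def Y_def W_def card_2_iff)
  then have "Tstar_shape r m G X Y W 0"
    unfolding Tstar_shape_def adjG using m assms
    by (auto simp: G_def X_def Y_def W_def R_def)
  then show ?thesis by blast
qed

lemma Tstar_shape_glued:
  assumes "Tstar_shape r m G X Y W x0" "r \<ge> 1"
  shows "fin_graph.glued (verts G) (adj G) X Y W x0"
proof -
  interpret fin_graph "verts G" "adj G" by (rule fin_graph_adj) (use assms in \<open>auto simp: Tstar_shape_def\<close>)
  show ?thesis
    using assms unfolding glued_def bipartition_def Tstar_shape_def by auto
qed

lemma Tstar_shape_counts:
  assumes T: "Tstar_shape r m G X Y W x0" and r: "r \<ge> 1" and a: "a \<ge> 2" and l: "r \<le> 2 * l"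
  shows "card (verts G) = m + r - 1"
    "card (cycle_lists (adj G) (verts G) (2 * a)) = balanced_count a m + falling r (2 * a)"
    "cycle_lists (adj G) (verts G) (2 * l + 1) = {}"
    "\<not> colorable (r - 1) G"
proof -
  interpret fin_graph "verts G" "adj G" by (rule fin_graph_adj) (use T in \<open>auto simp: Tstar_shape_def\<close>)
  have g: "glued X Y W x0" using Tstar_shape_glued[OF T r] .
  have bip: "bipartition X Y" using g by (simp add: glued_def)
  note c = glued_cards[OF g]
  have cards: "card X = m div 2" "card Y = m - m div 2" "card W = r - 1" using T by (auto simp: Tstar_shape_def)
  show "card (verts G) = m + r - 1" using c(1) cards r by simp
  have K: "card (insert x0 W) = r" using c(2) cards r by simp
  have clique: "adj G u v" if "u \<in> insert x0 W" "v \<in> insert x0 W" "u \<noteq> v" for u v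
    using T that unfolding Tstar_shape_def by blast
  have 1: "card (cycle_lists (adj G) (insert x0 W) (2 * a)) = falling r (2 * a)"
    using card_cycle_lists_clique[OF _ clique, of "insert x0 W" "2 * a"] c K a by simp
  have 2: "card (cycle_lists (adj G) (X \<union> Y) (2 * a)) = balanced_count a m"
  proof -
    have "adj G x y" if "x \<in> X" "y \<in> Y" for x y
      using T that unfolding Tstar_shape_def by blast
    then show ?thesis
      using card_cycle_lists_complete_bipartite[OF bip, of a] a cards by (simp add: balanced_count_def)
  qed
  show "card (cycle_lists (adj G) (verts G) (2 * a)) = balanced_count a m + falling r (2 * a)"
    using card_cycle_lists_glued[OF g, of "2 * a"] a 1 2 by simp
  have "cycle_lists (adj G) (insert x0 W) (2 * l + 1) = {}"
  proof -
    have "card (set vs) \<le> r" if "set vs \<subseteq> insert x0 W" for vs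
      using card_mono[OF _ that] K c by simp
    then show ?thesis using l by (fastforce simp: cycle_lists_def cyclic_def distinct_card)
  qed
  then show "cycle_lists (adj G) (verts G) (2 * l + 1) = {}"
    using cycle_lists_glued[OF g] cycle_lists_bipartition_odd[OF bip] by simp
  show "\<not> colorable (r - 1) G"
  proof
    assume "colorable (r - 1) G"
    then obtain f :: "_ \<Rightarrow> nat" where f: "f ` verts G \<subseteq> {..<r - 1}" "\<And>u v. adj G u v \<Longrightarrow> f u \<noteq> f v"
      by (auto simp: colorable_def adj_def)
    have "inj_on f (insert x0 W)" using f(2) clique by (auto simp: inj_on_def)
    moreover have "f ` insert x0 W \<subseteq> {..<r - 1}" using f(1) T by (auto simp: Tstar_shape_def)
    ultimately have "card (insert x0 W) \<le> card {..<r - 1}" by (intro card_inj_on_le) auto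
    then show False using K r by simp
  qed
qed

lemma chromatic_number_ge_iff:
  assumes "simple_graph G"
  shows "r \<le> chromatic_number G \<longleftrightarrow> r = 0 \<or> \<not> colorable (r - 1) G"
proof -
  have mono: "colorable k' G" if "colorable k G" "k \<le> k'" for k k'
    using that unfolding colorable_def by (meson lessThan_subset_iff subset_trans)
  have "finite (verts G)" using assms by (simp add: simple_graph_def)
  then obtain f :: "'a \<Rightarrow> nat" where f: "inj_on f (verts G)" "f ` verts G = {0..<card (verts G)}"
    using ex_bij_betw_finite_nat[of "verts G"] by (auto simp: bij_betw_def)
  have "colorable (card (verts G)) G"
    unfolding colorable_def
  proof (intro exI conjI allI impI)
    show "f ` verts G \<subseteq> {..<card (verts G)}" using f by auto
    interpret fin_graph "verts G" "adj G" by (rule fin_graph_adj[OF assms])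
    show "f u \<noteq> f v" if "{u, v} \<in> edges G" for u v
    proof -
      have e: "adj G u v" using that by (simp add: adj_def)
      then show ?thesis using E_in[OF e] E_in[OF E_sym[OF e]] E_irrefl[of u] f(1) by (auto simp: inj_on_def)
    qed
  qed
  then have "colorable (chromatic_number G) G" unfolding chromatic_number_def by (rule LeastI)
  moreover have "chromatic_number G \<le> k" if "colorable k G" for k
    unfolding chromatic_number_def using that by (rule Least_le)
  ultimately show ?thesis using mono
    by (metis One_nat_def Suc_diff_1 diff_le_self le_less_Suc_eq less_Suc_eq_le not_le gr0I order.trans le0)
qed

section \<open>Counting the cycles outside the bipartite part\<close>

context fin_graph begin

text \<open>Rotate such a list so that \<open>w\<close> comes first: its successor is a neighbour of \<open>w\<close>, the remaining
\<open>t - 2\<close> entries are arbitrary.\<close>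

lemma cycle_lists_through_vertex:
  assumes "t \<ge> 2"
  shows "card {vs \<in> cycle_lists E V t. w \<in> set vs} \<le> t * (card (nbrs w) * card V ^ (t - 2))"
proof -
  let ?R = "{vs. set vs \<subseteq> V \<and> length vs = t - 2}"
  let ?P = "{1..t} \<times> (nbrs w \<times> ?R)"
  have finR: "finite ?R" using finite_lists_length_eq[OF finV] .
  have "{vs \<in> cycle_lists E V t. w \<in> set vs} \<subseteq> (\<lambda>(j, u, rs). rotate j (w # u # rs)) ` ?P"
  proof
    fix vs assume "vs \<in> {vs \<in> cycle_lists E V t. w \<in> set vs}"
    then have vs: "length vs = t" "set vs \<subseteq> V" "successively E vs" "E (last vs) (hd vs)" "w \<in> set vs"
      by (auto simp: cycle_lists_def cyclic_def)
    obtain ps qs where s: "vs = ps @ w # qs" using vs(5) by (auto simp: in_set_conv_decomp)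
    have "length (qs @ ps) = t - 1" using vs(1) s by simp
    then obtain u rs where u: "qs @ ps = u # rs" using assms by (cases "qs @ ps") auto
    have "E w u"
    proof (cases qs)
      case Nil
      then show ?thesis using vs(4) s u by auto
    next
      case (Cons q qs')
      then show ?thesis using vs(3) s u by (auto simp: successively_append_iff)
    qed
    moreover have "rs \<in> ?R"
    proof -
      have "set (u # rs) \<subseteq> V" "length (u # rs) = t - 1" using vs s unfolding u[symmetric] by auto
      then show ?thesis using assms by auto
    qed
    moreover have "vs = rotate (length (w # qs)) (w # u # rs)"
      unfolding s u[symmetric] using rotate_append[of "w # qs" ps] by simp
    moreover have "length (w # qs) \<in> {1..t}" using vs(1) s by auto
    ultimately show "vs \<in> (\<lambda>(j, u, rs). rotate j (w # u # rs)) ` ?P"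
      by (intro image_eqI[of _ _ "(length (w # qs), u, rs)"]) auto
  qed
  then have "card {vs \<in> cycle_lists E V t. w \<in> set vs} \<le> card ?P"
    by (intro surj_card_le) (use finR in auto)
  also have "\<dots> = t * (card (nbrs w) * card V ^ (t - 2))"
    using card_lists_length_eq[OF finV, of "t - 2"] by (simp add: card_cartesian_product)
  finally show ?thesis .
qed

lemma cycle_lists_split:
  assumes "finite W" "V \<subseteq> U \<union> W" "U \<subseteq> V" "t \<ge> 2" "\<And>w. w \<in> W \<Longrightarrow> card (nbrs w) \<le> d"
  shows "card (cycle_lists E V t) \<le> card (cycle_lists E U t) + card W * (t * (d * card V ^ (t - 2)))"
proof -
  have "cycle_lists E V t \<subseteq> cycle_lists E U t \<union> (\<Union>w\<in>W. {vs \<in> cycle_lists E V t. w \<in> set vs})"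
    using assms(2) by (fastforce simp: cycle_lists_def)
  then have "card (cycle_lists E V t) \<le> card (cycle_lists E U t \<union> (\<Union>w\<in>W. {vs \<in> cycle_lists E V t. w \<in> set vs}))"
    by (intro card_mono) (use finite_cycle_lists assms in auto)
  also have "\<dots> \<le> card (cycle_lists E U t) + card (\<Union>w\<in>W. {vs \<in> cycle_lists E V t. w \<in> set vs})"
    by (rule card_Un_le)
  also have "card (\<Union>w\<in>W. {vs \<in> cycle_lists E V t. w \<in> set vs}) \<le> (\<Sum>w\<in>W. card {vs \<in> cycle_lists E V t. w \<in> set vs})"
    by (rule card_UN_le[OF assms(1)])
  also have "\<dots> \<le> (\<Sum>w\<in>W. t * (d * card V ^ (t - 2)))"
    using assms(5) by (intro sum_mono order_trans[OF cycle_lists_through_vertex[OF assms(4)]] mult_left_mono mult_right_mono) auto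
  also have "\<dots> = card W * (t * (d * card V ^ (t - 2)))" by simp
  finally show ?thesis by simp
qed

text \<open>The numbers of missing neighbours add up to the number of missing cross pairs, so Markov's inequality
applies.\<close>

lemma few_bad_vertices:
  fixes M :: real
  assumes "finite S" "finite T" "real (card S * card T) - real (ordered_edges S T) \<le> M"
  shows "real (card {x \<in> S. m < card (T - nbrs x)}) * real (Suc m) \<le> M"
proof -
  let ?B = "{x \<in> S. m < card (T - nbrs x)}"
  have "card ?B * Suc m = (\<Sum>x\<in>?B. Suc m)" by simp
  also have "\<dots> \<le> (\<Sum>x\<in>?B. card (T - nbrs x))" by (intro sum_mono) auto
  also have "\<dots> \<le> (\<Sum>x\<in>S. card (T - nbrs x))" using assms by (intro sum_mono2) auto
  finally have "card ?B * Suc m \<le> (\<Sum>x\<in>S. card (T - nbrs x))" .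
  moreover have "(\<Sum>x\<in>S. card (T - nbrs x)) + ordered_edges S T = card S * card T"
  proof -
    have "card (T - nbrs x) + card (nbrs x \<inter> T) = card T" for x
      using assms by (subst card_Un_disjoint[symmetric]) (auto intro: arg_cong[where f = card])
    then have "(\<Sum>x\<in>S. card (T - nbrs x) + card (nbrs x \<inter> T)) = card S * card T" by simp
    then show ?thesis using assms by (simp add: ordered_edges_sum sum.distrib)
  qed
  ultimately have "card ?B * Suc m + ordered_edges S T \<le> card S * card T" by linarith
  then have "real (card ?B * Suc m + ordered_edges S T) \<le> real (card S * card T)" using of_nat_mono by blast
  then show ?thesis using assms(3) by (simp only: of_nat_add of_nat_mult)
qed

text \<open>The core consists of the vertices on each side that miss at most \<open>m\<close> vertices of the other side, where \<open>m\<close>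
is about \<open>\<delta>n/2\<close>. As \<open>O(n)\<close> pairs are missing in total, boundedly many vertices are dropped.\<close>

lemma near_complete_core:
  fixes K \<delta> :: real
  assumes n: "n = card V" and ST: "S \<union> T = V" "S \<inter> T = {}"
    and miss: "real (card S * card T) - real (ordered_edges S T) \<le> K * n"
    and diff: "(real (card S) - real (card T))\<^sup>2 \<le> 2 * K * n"
    and m: "\<delta> * n / 2 \<le> Suc m" and D: "D + m \<le> 4 * real n / 10"
    and \<delta>: "\<delta> > 0" and K: "K \<ge> 0" and big: "n > 0" "real n \<ge> 200 * K" "real n \<ge> 40 * K / \<delta>"
  obtains X Y where "near_complete m D X Y" "real (card (V - (X \<union> Y))) \<le> 4 * K / \<delta>"
    "real (card X) \<ge> 4 * real n / 10" "real (card Y) \<ge> 4 * real n / 10"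
proof -
  have fin: "finite S" "finite T" using ST(1) finV by (metis finite_Un)+
  have cn: "real n = real (card S) + real (card T)"
    using card_Un_disjoint[OF fin ST(2)] ST(1) n by simp
  have npos: "real n > 0" using big(1) by simp
  have "(real (card S) - real (card T))\<^sup>2 \<le> (n / 10)\<^sup>2"
  proof -
    have "2 * K * n \<le> (n / 10) * (n / 10)"
      using mult_right_mono[OF big(2), of "real n / 100"] by simp
    then show ?thesis using diff by (simp add: power2_eq_square)
  qed
  then have "\<bar>real (card S) - real (card T)\<bar> \<le> n / 10"
    using power2_le_iff_abs_le[of "real n / 10"] by simp
  then have half: "real (card S) \<ge> 45 * real n / 100" "real (card T) \<ge> 45 * real n / 100"
    using cn by (auto simp: abs_if split: if_splits)
  define X where "X = {x \<in> S. card (T - nbrs x) \<le> m}"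
  define Y where "Y = {y \<in> T. card (S - nbrs y) \<le> m}"
  have bound: "real (card B) \<le> 2 * K / \<delta>" if "real (card B) * real (Suc m) \<le> K * n" for B :: "'a set"
  proof -
    have "real (card B) * (\<delta> * n / 2) \<le> real (card B) * real (Suc m)"
      using m by (intro mult_left_mono) auto
    then have "(real (card B) * \<delta>) * n \<le> (2 * K) * n" using that by (simp add: algebra_simps)
    then have "real (card B) * \<delta> \<le> 2 * K" using npos by (simp only: mult_le_cancel_right_pos)
    then show ?thesis using \<delta> by (simp add: pos_le_divide_eq)
  qed
  have "S - X = {x \<in> S. m < card (T - nbrs x)}" by (auto simp: X_def)
  then have BX: "real (card (S - X)) \<le> 2 * K / \<delta>" using few_bad_vertices[OF fin miss] bound by metis
  have miss': "real (card T * card S) - real (ordered_edges T S) \<le> K * n"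
    using miss by (simp add: ordered_edges_sym[of T S] mult.commute)
  have "T - Y = {x \<in> T. m < card (S - nbrs x)}" by (auto simp: Y_def)
  then have BY: "real (card (T - Y)) \<le> 2 * K / \<delta>" using few_bad_vertices[OF fin(2,1) miss'] bound by metis
  have sub: "X \<subseteq> S" "Y \<subseteq> T" by (auto simp: X_def Y_def)
  have cX: "real (card S) = real (card X) + real (card (S - X))"
    using fin sub card_mono[OF fin(1) sub(1)] by (simp add: card_Diff_subset finite_subset)
  have cY: "real (card T) = real (card Y) + real (card (T - Y))"
    using fin sub card_mono[OF fin(2) sub(2)] by (simp add: card_Diff_subset finite_subset)
  have "2 * K / \<delta> \<le> 5 * real n / 100" using big(3) by simp
  then have X4: "real (card X) \<ge> 4 * real n / 10" and Y4: "real (card Y) \<ge> 4 * real n / 10"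
    using cX cY BX BY half by auto
  have "near_complete m D X Y"
    unfolding near_complete_def
  proof (intro conjI ballI)
    show "X \<subseteq> V" "Y \<subseteq> V" "X \<inter> Y = {}" using sub ST by auto
    show "card (Y - nbrs x) \<le> m" if "x \<in> X" for x
    proof -
      have "card (Y - nbrs x) \<le> card (T - nbrs x)" using sub fin by (intro card_mono) auto
      then show ?thesis using that by (simp add: X_def)
    qed
    show "card (X - nbrs y) \<le> m" if "y \<in> Y" for y
    proof -
      have "card (X - nbrs y) \<le> card (S - nbrs y)" using sub fin by (intro card_mono) auto
      then show ?thesis using that by (simp add: Y_def)
    qed
    show "D + m \<le> card X" using D X4 by linarith
    show "D + m \<le> card Y" using D Y4 by linarith
  qed
  moreover have "real (card (V - (X \<union> Y))) \<le> 4 * K / \<delta>"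
  proof -
    have "V - (X \<union> Y) \<subseteq> (S - X) \<union> (T - Y)" using ST by auto
    then have "card (V - (X \<union> Y)) \<le> card ((S - X) \<union> (T - Y))" using fin by (intro card_mono) auto
    also have "\<dots> \<le> card (S - X) + card (T - Y)" by (rule card_Un_le)
    finally have "real (card (V - (X \<union> Y))) \<le> real (card (S - X)) + real (card (T - Y))" by linarith
    then show ?thesis using BX BY by (simp add: field_simps)
  qed
  ultimately show ?thesis using that X4 Y4 by blast
qed

lemma poorly_attached_degree:
  assumes w: "w \<in> V - (well_attached D Y \<union> well_attached D X)"
  shows "card (nbrs w) \<le> 2 * D + card (V - (X \<union> Y))"
proof -
  have "card (nbrs w \<inter> Y) \<le> D" "card (nbrs w \<inter> X) \<le> D" using w by (auto simp: well_attached_def)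
  moreover have "card (nbrs w) \<le> card (nbrs w \<inter> X \<union> nbrs w \<inter> Y \<union> (V - (X \<union> Y)))"
    using nbrs_sub finV by (intro card_mono) auto
  moreover have "\<dots> \<le> card (nbrs w \<inter> X) + card (nbrs w \<inter> Y) + card (V - (X \<union> Y))"
    using card_Un_le[of "nbrs w \<inter> X \<union> nbrs w \<inter> Y" "V - (X \<union> Y)"] card_Un_le[of "nbrs w \<inter> X" "nbrs w \<inter> Y"]
    by linarith
  ultimately show ?thesis by linarith
qed

text \<open>With \<open>|W| = r - 1 + j\<close>, the bipartite part is \<open>j\<close> vertices short, which costs \<open>2aj s^(2a-1)\<close> lists by
\<open>balanced_count_steps\<close>. The vertices of \<open>W\<close> return at most \<open>6a |W| \<delta> n^(2a-1)\<close>. Since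
\<open>|W| \<le> jr\<close> for \<open>j \<ge> 1\<close>, the choice of \<open>\<delta>\<close> does not depend on the size of \<open>W\<close>.\<close>

lemma outside_small:
  fixes \<delta> :: real
  assumes bip: "bipartition X Y" and W: "W = V - (X \<union> Y)" and n: "n = card V" and a: "a \<ge> 1" and r: "r \<ge> 1"
    and many: "balanced_count a (n + 1 - r) \<le> card (cycle_lists E V (2 * a))"
    and split: "real (card (cycle_lists E V (2 * a))) \<le> real (card (cycle_lists E (X \<union> Y) (2 * a))) + card W * (2 * a * (3 * \<delta> * n ^ (2 * a - 1)))"
    and s: "s + a \<le> (n - card W) div 2" "real n / 8 \<le> s" "n > 0"
    and \<delta>: "3 * real r * \<delta> < 1 / 8 ^ (2 * a - 1)" "\<delta> \<ge> 0"
  shows "card W \<le> r - 1"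
proof (rule ccontr)
  assume "\<not> card W \<le> r - 1"
  then obtain j where j: "card W = r - 1 + j" "j \<ge> 1"
    by (metis le_add_diff_inverse less_imp_le_nat not_le zero_less_diff less_one)
  have fin: "finite X" "finite Y" "X \<inter> Y = {}" "X \<union> Y \<subseteq> V"
    using bip finV finite_subset by (auto simp: bipartition_def)
  have cW: "card W = n - (card X + card Y)" "card X + card Y \<le> n"
    using fin card_Un_disjoint[OF fin(1-3)] card_mono[OF finV fin(4)]
    by (auto simp: W n card_Diff_subset)
  have sum: "card X + card Y = n - card W" using cW by simp
  have nW: "n - card W + j = n + 1 - r" using j r cW by linarith
  have "card (cycle_lists E (X \<union> Y) (2 * a)) \<le> balanced_count a (n - card W)"
    using card_cycle_lists_bipartition_le[OF bip a] falling_prod_balanced_count[OF a, of "card X" "card Y"] sum by simp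
  moreover have "balanced_count a (n - card W) + j * (2 * a * s ^ (2 * a - 1)) \<le> balanced_count a (n + 1 - r)"
    using balanced_count_steps[OF s(1) a, of j] nW by simp
  ultimately have "card (cycle_lists E (X \<union> Y) (2 * a)) + j * (2 * a * s ^ (2 * a - 1)) \<le> card (cycle_lists E V (2 * a))"
    using many by linarith
  then have "real (card (cycle_lists E (X \<union> Y) (2 * a)) + j * (2 * a * s ^ (2 * a - 1))) \<le> real (card (cycle_lists E V (2 * a)))"
    using of_nat_mono by blast
  then have "real j * (2 * a * real s ^ (2 * a - 1)) \<le> real (card W) * (2 * a * (3 * \<delta> * n ^ (2 * a - 1)))"
    using split by (simp only: of_nat_add of_nat_mult of_nat_power of_nat_numeral)
  also have "\<dots> \<le> real (j * r) * (2 * a * (3 * \<delta> * n ^ (2 * a - 1)))"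
  proof (intro mult_right_mono of_nat_mono)
    have "(r - 1) * 1 \<le> (r - 1) * j" using j by (intro mult_left_mono) auto
    then show "card W \<le> j * r" using j r by (cases r) (auto simp: algebra_simps)
  qed (use \<delta> in auto)
  finally have "(real j * (2 * a)) * real s ^ (2 * a - 1) \<le> (real j * (2 * a)) * (3 * real r * \<delta> * n ^ (2 * a - 1))"
    by (simp add: mult_ac)
  moreover have "real j * (2 * a) > 0" using j a by simp
  ultimately have "real s ^ (2 * a - 1) \<le> 3 * real r * \<delta> * n ^ (2 * a - 1)"
    by (simp only: mult_le_cancel_left_pos)
  moreover have "(real n / 8) ^ (2 * a - 1) \<le> real s ^ (2 * a - 1)" using s by (intro power_mono) auto
  moreover have "3 * real r * \<delta> * n ^ (2 * a - 1) < 1 / 8 ^ (2 * a - 1) * n ^ (2 * a - 1)"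
    using \<delta> s(3) by (intro mult_strict_right_mono) auto
  ultimately show False by (simp add: power_divide)
qed

text \<open>If \<open>|W| = r - 1\<close>, the bipartite part has the right order and can lose only as many lists as pass through \<open>W\<close>.
Every vertex missed by \<open>x\<close> costs of the order of \<open>n^(2a-2)\<close> lists.\<close>

lemma missing_small:
  fixes \<delta> :: real
  assumes bip: "bipartition X Y" and W: "W = V - (X \<union> Y)" and n: "n = card V" and a: "a \<ge> 1" and r: "r \<ge> 1"
    and cW: "card W = r - 1"
    and many: "balanced_count a (n + 1 - r) \<le> card (cycle_lists E V (2 * a))"
    and split: "real (card (cycle_lists E V (2 * a))) \<le> real (card (cycle_lists E (X \<union> Y) (2 * a))) + card W * (2 * a * (3 * \<delta> * n ^ (2 * a - 1)))"
    and s: "s + a \<le> card X" "s + a \<le> card Y" "real n / 8 \<le> s" "n > 0"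
    and \<delta>: "6 * real a * real r * \<delta> * 8 ^ (2 * a - 2) \<le> 1 / 10" "\<delta> \<ge> 0"
    and x: "x \<in> X"
  shows "real (card (Y - nbrs x)) \<le> n / 10"
proof -
  have fin: "finite X" "finite Y" "X \<inter> Y = {}" "X \<union> Y \<subseteq> V"
    using bip finV finite_subset by (auto simp: bipartition_def)
  have "card W = n - (card X + card Y)" "card X + card Y \<le> n"
    using fin card_Un_disjoint[OF fin(1-3)] card_mono[OF finV fin(4)]
    by (auto simp: W n card_Diff_subset)
  then have sum: "card X + card Y = n + 1 - r" using cW r by linarith
  let ?M = "card (Y - nbrs x)"
  have "card (cycle_lists E (X \<union> Y) (2 * a)) + ?M * (falling (card X - 1) (a - 1) * falling (card Y - 1) (a - 1))
     \<le> card (cycle_lists E V (2 * a))"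
    using card_cycle_lists_bipartition[OF bip x a] falling_prod_balanced_count[OF a, of "card X" "card Y"] sum many by simp
  moreover have "?M * s ^ (2 * a - 2) \<le> ?M * (falling (card X - 1) (a - 1) * falling (card Y - 1) (a - 1))"
  proof -
    have "(a - 1) + (a - 1) = 2 * a - 2" using a by simp
    then have "s ^ (2 * a - 2) = s ^ (a - 1) * s ^ (a - 1)" by (simp only: flip: power_add)
    moreover have "s ^ (a - 1) \<le> falling k (a - 1)" if "s + (a - 1) \<le> k" for k
      by (rule order_trans[OF power_mono falling_ge]) (use that in auto)
    then have "s ^ (a - 1) * s ^ (a - 1) \<le> falling (card X - 1) (a - 1) * falling (card Y - 1) (a - 1)"
      using s a by (intro mult_mono) auto
    ultimately show ?thesis by (intro mult_left_mono) simp_all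
  qed
  ultimately have "card (cycle_lists E (X \<union> Y) (2 * a)) + ?M * s ^ (2 * a - 2) \<le> card (cycle_lists E V (2 * a))"
    by linarith
  then have "real (card (cycle_lists E (X \<union> Y) (2 * a)) + ?M * s ^ (2 * a - 2)) \<le> real (card (cycle_lists E V (2 * a)))"
    using of_nat_mono by blast
  then have "real ?M * real s ^ (2 * a - 2) \<le> real (card W) * (2 * a * (3 * \<delta> * n ^ (2 * a - 1)))"
    using split by simp
  also have "\<dots> \<le> real r * (2 * a * (3 * \<delta> * n ^ (2 * a - 1)))"
    using cW \<delta> by (intro mult_right_mono) auto
  also have "\<dots> = 6 * real a * real r * \<delta> * n * n ^ (2 * a - 2)"
  proof -
    have "2 * a - 1 = Suc (2 * a - 2)" using a by simp
    then show ?thesis by simp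
  qed
  finally have 1: "real ?M * real s ^ (2 * a - 2) \<le> 6 * real a * real r * \<delta> * n * n ^ (2 * a - 2)" .
  have "real ?M * (real n / 8) ^ (2 * a - 2) \<le> real ?M * real s ^ (2 * a - 2)"
    using s by (intro mult_left_mono power_mono) auto
  then have "real ?M * (real n / 8) ^ (2 * a - 2) \<le> 6 * real a * real r * \<delta> * n * n ^ (2 * a - 2)" using 1 by simp
  then have "real ?M * real n ^ (2 * a - 2) \<le> (6 * real a * real r * \<delta> * 8 ^ (2 * a - 2) * n) * real n ^ (2 * a - 2)"
    by (simp add: power_divide divide_le_eq mult_ac)
  then have "real ?M \<le> 6 * real a * real r * \<delta> * 8 ^ (2 * a - 2) * n"
    using s(4) by (subst (asm) mult_le_cancel_right_pos) auto
  also have "\<dots> \<le> 1 / 10 * n" using \<delta> by (intro mult_right_mono) auto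
  finally show ?thesis by simp
qed

text \<open>\<open>unique_attachment\<close> compares the attachment vertices of two different members of \<open>W\<close>. That a single \<open>w\<close> has
only one follows by comparing each of its attachment vertices with that of another member, which exists as
\<open>r - 1 \<ge> 2\<close>.\<close>

lemma attached_clique_glued:
  assumes free: "cycle_lists E V (2 * l + 1) = {}" and l2: "l \<ge> 2" and r: "r \<ge> 3"
    and nc: "near_complete m D X1 Y1" and D: "m + 2 * l + 6 \<le> D"
    and X: "X = well_attached D Y1" and bip: "bipartition X Y" and W: "W = V - (X \<union> Y)" "card W = r - 1"
    and miss: "\<And>x. x \<in> X \<Longrightarrow> 2 * card (Y - nbrs x) < card Y"
    and clique: "\<forall>w\<in>W. \<forall>w'\<in>W. w \<noteq> w' \<longrightarrow> E w w'"
    and side: "\<forall>w\<in>W. (\<exists>x\<in>X. E w x) \<and> (\<forall>y\<in>Y. \<not> E w y)"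
  shows "\<exists>x0. glued X Y W x0 \<and> (\<forall>u\<in>insert x0 W. \<forall>v\<in>insert x0 W. u \<noteq> v \<longrightarrow> E u v)"
proof -
  have un: "x = x'" if "w \<in> W" "w' \<in> W" "w \<noteq> w'" "x \<in> X" "x' \<in> X" "E w x" "E w' x'" for w w' x x'
  proof (rule unique_attachment[OF free l2 nc D X, of Y W w w'])
    show "Y \<subseteq> V" "Y \<inter> W = {}" "X \<inter> W = {}" using bip W by (auto simp: bipartition_def)
  qed (use miss clique that in auto)
  have other: "\<exists>w'\<in>W. w' \<noteq> w" for w
  proof -
    have "\<not> W \<subseteq> {w}" using card_mono[of "{w}" W] W(2) r by auto
    then show ?thesis by auto
  qed
  obtain w0 where w0: "w0 \<in> W" using other by blast
  then obtain x0 where x0: "x0 \<in> X" "E w0 x0" using side by blast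
  have att: "x = x0" if "w \<in> W" "x \<in> X" "E w x" for w x
  proof (cases "w = w0")
    case True
    obtain w1 where w1: "w1 \<in> W" "w1 \<noteq> w0" using other by blast
    then obtain x1 where x1: "x1 \<in> X" "E w1 x1" using side by blast
    show ?thesis using un[of w0 w1 x0 x1] un[of w0 w1 x x1] that True w0 w1 x0 x1 by auto
  next
    case False
    then show ?thesis using un[of w w0 x x0] that w0 x0 by auto
  qed
  have toW: "E w x0" if "w \<in> W" for w using side att that by blast
  have "glued X Y W x0"
    unfolding glued_def
  proof (intro conjI bip W(1) allI impI)
    show "x0 \<in> X \<union> Y" using x0 by simp
    fix u v assume uv: "E u v" "u \<in> W"
    have "v \<in> V" using uv E_in[OF E_sym] by blast
    then show "v \<in> insert x0 W" using uv att side W(1) by blast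
  qed
  moreover have "E u v" if "u \<in> insert x0 W" "v \<in> insert x0 W" "u \<noteq> v" for u v
    using that clique toW E_sym by blast
  ultimately show ?thesis by blast
qed

end

section \<open>Extremal graphs\<close>

lemma balanced_count_ge:
  assumes "r + 2 * a \<le> n"
  shows "2 * ((real n - real (r + 2 * a)) / 2) ^ (2 * a) \<le> real (balanced_count a (n + 1 - r))"
proof -
  define m where "m = n + 1 - r"
  let ?B = "(real n - real (r + 2 * a)) / 2"
  have B: "?B \<ge> 0" using assms by simp
  have *: "?B ^ a \<le> real (falling k a)" if "m div 2 \<le> k" for k
  proof -
    have "n \<le> r + 2 * (m div 2)" unfolding m_def by linarith
    then have "n \<le> r + 2 * k" using that by linarith
    then have "real n \<le> real (r + 2 * k)" by (rule of_nat_mono)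
    moreover have "real k - real a \<le> real (k - a)" by (cases "a \<le> k") (simp_all add: of_nat_diff)
    ultimately have "?B \<le> real (k - a)" by simp
    then have "?B ^ a \<le> real (k - a) ^ a" using B by (intro power_mono)
    also have "\<dots> \<le> real (falling k a)" using falling_ge[of k a] by (metis of_nat_le_iff of_nat_power)
    finally show ?thesis .
  qed
  have "?B ^ (2 * a) = ?B ^ a * ?B ^ a" by (simp only: mult_2 power_add)
  also have "\<dots> \<le> real (falling (m div 2) a) * real (falling (m - m div 2) a)"
    by (rule mult_mono[OF *[of "m div 2"] *[of "m - m div 2"]]) (use zero_le_power[OF B, of a] in auto)
  finally have "?B ^ (2 * a) \<le> real (falling (m div 2) a) * real (falling (m - m div 2) a)" .
  moreover have "real (balanced_count a m) = 2 * (real (falling (m div 2) a) * real (falling (m - m div 2) a))"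
    by (simp add: balanced_count_def)
  ultimately show ?thesis unfolding m_def[symmetric] by linarith
qed

text \<open>The fraction \<open>\<delta>\<close> of \<open>n\<close> below which a vertex counts as poorly attached. It is small enough for
\<open>outside_small\<close> and \<open>missing_small\<close>, where the parts of the graph are only known to have at least about
\<open>n/8\<close> vertices to spare; hence the powers of 8.\<close>

definition degree_threshold :: "nat \<Rightarrow> nat \<Rightarrow> real" where
  "degree_threshold a r = 1 / (100 * a * r * 8 ^ (2 * a))"

lemma degree_threshold_facts:
  fixes a r :: nat
  assumes "a \<ge> 1" "r \<ge> 1"
  shows "degree_threshold a r > 0" "degree_threshold a r \<le> 1 / 100" "3 * real r * degree_threshold a r < 1 / 8 ^ (2 * a - 1)"
    "6 * real a * real r * degree_threshold a r * 8 ^ (2 * a - 2) \<le> 1 / 10"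
proof -
  have p: "(8::real) ^ (2 * a) = 8 * 8 ^ (2 * a - 1)" "(8::real) ^ (2 * a) = 64 * 8 ^ (2 * a - 2)"
  proof -
    obtain b where "a = Suc b" using assms(1) by (cases a) auto
    then show "(8::real) ^ (2 * a) = 8 * 8 ^ (2 * a - 1)" "(8::real) ^ (2 * a) = 64 * 8 ^ (2 * a - 2)"
      by simp_all
  qed
  have ra: "real a > 0" "real r > 0" "real a \<ge> 1" "real r \<ge> 1" using assms by auto
  show "degree_threshold a r > 0" using ra by (simp add: degree_threshold_def)
  have "1 * 1 \<le> real a * real r" using ra by (intro mult_mono) auto
  then have "1 * 1 \<le> (real a * real r) * 8 ^ (2 * a)" by (intro mult_mono) auto
  then show "degree_threshold a r \<le> 1 / 100" unfolding degree_threshold_def by (intro divide_left_mono) auto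
  show "3 * real r * degree_threshold a r < 1 / 8 ^ (2 * a - 1)"
    unfolding degree_threshold_def p(1) using ra by (simp add: field_simps)
  show "6 * real a * real r * degree_threshold a r * 8 ^ (2 * a - 2) \<le> 1 / 10"
    unfolding degree_threshold_def p(2) using ra by (simp add: field_simps)
qed

context fin_graph begin

text \<open>The constant \<open>K\<close> bounds the linear error terms: the maximum degree partition misses at most \<open>Kn\<close> cross pairs,
and at most \<open>4K/\<delta>\<close> vertices lie outside the core. The lower bounds on \<open>n\<close> serve, in this order, the
balance of the partition, the size of the core, the avoidance of boundedly many vertices by paths, the degrees
of poorly attached vertices, and the margin of about \<open>n/8 + a\<close> in the sizes of the parts.\<close>

lemma extremal_glued:
  fixes l a r :: nat and \<delta> K :: real
  assumes l: "l \<ge> 2" and a: "a \<ge> 2" and r: "r \<ge> 3" and n: "n = card V"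
    and free: "cycle_lists E V (2 * l + 1) = {}" and ncol: "\<not> proper_colorable (r - 1)"
    and many: "balanced_count a (n + 1 - r) \<le> card (cycle_lists E V (2 * a))"
    and \<delta>: "\<delta> = degree_threshold a r" and K: "K = real (r + 2 * a + 8 * l)"
    and big: "real n \<ge> 200 * K" "real n \<ge> 40 * K / \<delta>" "real n \<ge> (4 * l + 20) / \<delta>"
      "real n \<ge> (4 * K / \<delta> + 2) / \<delta>" "real n \<ge> 8 * (2 + a + 4 * K / \<delta>)"
  shows "\<exists>X Y W x0. glued X Y W x0 \<and> card W = r - 1 \<and> a \<le> card X \<and> a \<le> card Y \<and>
    (\<forall>u\<in>insert x0 W. \<forall>v\<in>insert x0 W. u \<noteq> v \<longrightarrow> E u v)"
proof -
  have a1: "a \<ge> 1" and r1: "r \<ge> 1" using a r by auto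
  note d = degree_threshold_facts[OF a1 r1, folded \<delta>]
  have Kpos: "K \<ge> 1" using r by (simp add: K)
  have npos: "n > 0" "real n \<ge> 200" using big(1) Kpos by auto
  have nr: "r + 2 * a \<le> n"
  proof -
    have "real (r + 2 * a) \<le> K" by (simp add: K)
    then have "real (r + 2 * a) \<le> real n" using big(1) Kpos by linarith
    then show ?thesis by (simp only: of_nat_le_iff)
  qed
  obtain S T where ST: "S \<union> T = V" "S \<inter> T = {}"
    "real (card S * card T) - real (ordered_edges S T) \<le> K * n"
    "(real (card S) - real (card T))\<^sup>2 \<le> 2 * K * n"
  proof -
    let ?B = "(real n - real (r + 2 * a)) / 2"
    have "2 * ?B ^ (2 * a) \<le> real (card (cycle_lists E V (2 * a)))"
      using balanced_count_ge[OF nr] many by linarith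
    then have "2 * ?B\<^sup>2 - 4 * l * card V \<le> real (ordered_edges V V)"
      using nr l a by (intro edges_many[OF free]) auto
    moreover have "2 * ?B\<^sup>2 \<ge> (real n)\<^sup>2 / 2 - real (r + 2 * a) * n"
      by (simp add: power2_eq_square field_simps)
    ultimately have "(real n)\<^sup>2 / 2 - real (r + 2 * a + 4 * l) * n \<le> real (ordered_edges V V)"
      by (simp add: n[symmetric] algebra_simps)
    moreover have "real (r + 2 * a + 4 * l) + 4 * l = K" by (simp add: K)
    ultimately show ?thesis
      using max_degree_partition[OF free, of "real (r + 2 * a + 4 * l)"] that l n by auto
  qed
  \<comment> \<open>half the threshold, so that \<open>D - m\<close> exceeds every bounded number of vertices to be avoided\<close>
  define m where "m = nat \<lfloor>\<delta> * n / 2\<rfloor>"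
  define D where "D = nat \<lceil>\<delta> * n\<rceil>"
  have dn: "\<delta> * n \<ge> 0" using d by simp
  have m: "real m \<le> \<delta> * n / 2" "\<delta> * n / 2 \<le> Suc m" using dn unfolding m_def by linarith+
  have D: "\<delta> * n \<le> real D" "real D \<le> \<delta> * n + 1" using dn unfolding D_def by linarith+
  have b3: "4 * l + 20 \<le> \<delta> * n" using big(3) d(1) by (simp add: pos_divide_le_eq mult.commute)
  have b4: "4 * K / \<delta> + 2 \<le> \<delta> * n" using big(4) d(1) by (simp add: pos_divide_le_eq mult.commute)
  have dn2: "\<delta> * n \<le> real n / 100" using mult_right_mono[OF d(2), of "real n"] by simp
  have mD: "m + 2 * l + 6 \<le> D"
  proof -
    have "real (m + 2 * l + 6) \<le> real D" using m D b3 by simp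
    then show ?thesis by (simp only: of_nat_le_iff)
  qed
  obtain X1 Y1 where core: "near_complete m D X1 Y1" "real (card (V - (X1 \<union> Y1))) \<le> 4 * K / \<delta>"
    "real (card X1) \<ge> 4 * real n / 10" "real (card Y1) \<ge> 4 * real n / 10"
  proof (rule near_complete_core[OF n ST m(2)])
    show "real D + real m \<le> 4 * real n / 10" using m(1) D(2) dn2 npos(2) by linarith
  qed (use d Kpos npos big in auto)
  define X Y W where "X = well_attached D Y1" and "Y = well_attached D X1" and "W = V - (X \<union> Y)"
  have mD': "m + 2 * l + 4 \<le> D" using mD by simp
  have bip: "bipartition X Y"
    unfolding X_def Y_def by (rule bipartition_well_attached[OF free l core(1) mD'])
  have sub: "X1 \<subseteq> X" "Y1 \<subseteq> Y" using core_sub[OF free l core(1) mD'] by (auto simp: X_def Y_def)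
  have fin: "finite X" "finite Y" "finite W" "X \<union> Y \<subseteq> V"
    using bip finV finite_subset by (auto simp: bipartition_def W_def)
  have cXY: "real (card X) \<ge> 4 * real n / 10" "real (card Y) \<ge> 4 * real n / 10"
    using card_mono[OF fin(1) sub(1)] card_mono[OF fin(2) sub(2)] core(3,4) by linarith+
  have cW: "real (card W) \<le> 4 * K / \<delta>"
  proof -
    have "card W \<le> card (V - (X1 \<union> Y1))" using sub finV unfolding W_def by (intro card_mono) auto
    then show ?thesis using core(2) by linarith
  qed
  have split: "real (card (cycle_lists E V (2 * a))) \<le> real (card (cycle_lists E (X \<union> Y) (2 * a))) +
      real (card W) * (2 * real a * (3 * \<delta> * real n ^ (2 * a - 1)))"
  proof -
    let ?d = "2 * D + card (V - (X1 \<union> Y1))"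
    have "card (cycle_lists E V (2 * a)) \<le> card (cycle_lists E (X \<union> Y) (2 * a)) + card W * (2 * a * (?d * card V ^ (2 * a - 2)))"
    proof (rule cycle_lists_split)
      show "card (nbrs w) \<le> ?d" if "w \<in> W" for w
        using poorly_attached_degree[of w D Y1 X1] that by (simp add: W_def X_def Y_def)
    qed (use fin a in \<open>auto simp: W_def\<close>)
    then have "real (card (cycle_lists E V (2 * a))) \<le>
      real (card (cycle_lists E (X \<union> Y) (2 * a)) + card W * (2 * a * (?d * card V ^ (2 * a - 2))))"
      by (rule of_nat_mono)
    also have "\<dots> = real (card (cycle_lists E (X \<union> Y) (2 * a))) +
        real (card W) * (2 * real a * (real ?d * real n ^ (2 * a - 2)))"
      by (simp only: of_nat_add of_nat_mult of_nat_power of_nat_numeral n)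
    also have "\<dots> \<le> real (card (cycle_lists E (X \<union> Y) (2 * a))) +
        real (card W) * (2 * real a * ((3 * \<delta> * real n) * real n ^ (2 * a - 2)))"
    proof (intro add_left_mono mult_left_mono mult_right_mono)
      show "real ?d \<le> 3 * \<delta> * real n" using D core(2) b4 by simp
    qed auto
    also have "(3 * \<delta> * real n) * real n ^ (2 * a - 2) = 3 * \<delta> * real n ^ (2 * a - 1)"
    proof -
      have "2 * a - 1 = Suc (2 * a - 2)" using a by simp
      then show ?thesis by simp
    qed
    finally show ?thesis .
  qed
  \<comment> \<open>a common lower bound for the falling factors; it stays \<open>a\<close> below all part sizes\<close>
  define s where "s = nat \<lceil>real n / 8\<rceil>"
  have s: "real n / 8 \<le> s" "s \<le> real n / 8 + 1" unfolding s_def by linarith+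
  have b5: "real n \<ge> 16 + 8 * a + 8 * (4 * K / \<delta>)" using big(5) by simp
  have Kd: "4 * K / \<delta> \<ge> 0" using Kpos d by simp
  have sW: "s + a \<le> (n - card W) div 2"
  proof -
    have "real (2 * (s + a) + card W) \<le> real n" using s cW b5 Kd by simp
    then have "2 * (s + a) + card W \<le> n" by (simp only: of_nat_le_iff)
    then have "2 * (s + a) \<le> n - card W" by linarith
    from div_le_mono[OF this, of 2] show ?thesis by simp
  qed
  have sX: "s + a \<le> card X" "s + a \<le> card Y"
  proof -
    have "real (s + a) \<le> 4 * real n / 10" using s b5 Kd by simp
    then show "s + a \<le> card X" "s + a \<le> card Y" using cXY by linarith+
  qed
  have one: False if "w \<in> W" "x \<in> X" "y \<in> Y" "E w x" "E w y" for w x y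
    using not_both_sides[OF free l core(1) mD'] that unfolding X_def Y_def by blast
  have "r - 1 \<le> card W" by (rule not_proper_colorable_outside(1)[OF bip W_def one ncol r])
  moreover have "card W \<le> r - 1"
    by (rule outside_small[OF bip W_def n a1 r1 many split sW s(1) npos(1) d(3)]) (use d in simp)
  ultimately have cWr: "card W = r - 1" by simp
  have missX: "2 * card (Y - nbrs x) < card Y" if "x \<in> X" for x
  proof -
    have "real (card (Y - nbrs x)) \<le> n / 10"
      by (rule missing_small[OF bip W_def n a1 r1 cWr many split sX s(1) npos(1) d(4) _ that]) (use d in simp)
    then show ?thesis using cXY(2) npos by linarith
  qed
  have WYX: "W = V - (Y \<union> X)" by (auto simp: W_def)
  have missY: "2 * card (X - nbrs y) < card X" if "y \<in> Y" for y
  proof -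
    have "real (card (X - nbrs y)) \<le> n / 10"
      by (rule missing_small[OF bipartition_sym[OF bip] WYX n a1 r1 cWr many _ sX(2,1) s(1) npos(1) d(4) _ that])
         (use d split in \<open>simp_all add: Un_commute\<close>)
    then show ?thesis using cXY(1) npos by linarith
  qed
  have aXY: "a \<le> card X" "a \<le> card Y" using sX by auto
  have "(\<forall>w\<in>W. \<forall>w'\<in>W. w \<noteq> w' \<longrightarrow> E w w') \<and>
    ((\<forall>w\<in>W. (\<exists>x\<in>X. E w x) \<and> (\<forall>y\<in>Y. \<not> E w y)) \<or> (\<forall>w\<in>W. (\<exists>y\<in>Y. E w y) \<and> (\<forall>x\<in>X. \<not> E w x)))"
    by (rule not_proper_colorable_outside(2)[OF bip W_def one ncol r cWr])
  then have clique: "\<forall>w\<in>W. \<forall>w'\<in>W. w \<noteq> w' \<longrightarrow> E w w'"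
    and side: "(\<forall>w\<in>W. (\<exists>x\<in>X. E w x) \<and> (\<forall>y\<in>Y. \<not> E w y)) \<or> (\<forall>w\<in>W. (\<exists>y\<in>Y. E w y) \<and> (\<forall>x\<in>X. \<not> E w x))"
    by blast+
  from side show ?thesis
  proof
    assume "\<forall>w\<in>W. (\<exists>x\<in>X. E w x) \<and> (\<forall>y\<in>Y. \<not> E w y)"
    from attached_clique_glued[OF free l r core(1) mD X_def bip W_def cWr missX clique this]
    show ?thesis using cWr aXY by blast
  next
    assume "\<forall>w\<in>W. (\<exists>y\<in>Y. E w y) \<and> (\<forall>x\<in>X. \<not> E w x)"
    from attached_clique_glued[OF free l r near_complete_sym[OF core(1)] mD Y_def bipartition_sym[OF bip]
        WYX cWr missY clique this]
    show ?thesis using cWr aXY glued_sym by blast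
  qed
qed

end

lemma glued_imp_Tstar_shape:
  assumes G: "simple_graph G" and g: "fin_graph.glued (verts G) (adj G) X Y W x0"
    and c: "card X = m div 2" "card Y = m - m div 2" "card W = r - 1"
    and comp: "\<forall>x\<in>X. \<forall>y\<in>Y. adj G x y"
    and clique: "\<forall>u\<in>insert x0 W. \<forall>v\<in>insert x0 W. u \<noteq> v \<longrightarrow> adj G u v"
  shows "Tstar_shape r m G X Y W x0"
proof -
  interpret fin_graph "verts G" "adj G" by (rule fin_graph_adj[OF G])
  have b: "X \<subseteq> verts G" "Y \<subseteq> verts G" "X \<inter> Y = {}" "W = verts G - (X \<union> Y)" "x0 \<in> X \<union> Y"
    and ind: "\<And>u v. adj G u v \<Longrightarrow> \<not> (u \<in> X \<and> v \<in> X) \<and> \<not> (u \<in> Y \<and> v \<in> Y)"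
    and out: "\<And>u v. adj G u v \<Longrightarrow> u \<in> W \<Longrightarrow> v \<in> insert x0 W"
    using g by (auto simp: glued_def bipartition_def)
  show ?thesis
    unfolding Tstar_shape_def
  proof (intro conjI allI G c)
    show "verts G = X \<union> Y \<union> W" "X \<inter> Y = {}" "X \<inter> W = {}" "Y \<inter> W = {}" "x0 \<in> X \<union> Y"
      using b by auto
    fix u v
    show "adj G u v \<longleftrightarrow> u \<noteq> v \<and>
        (u \<in> X \<and> v \<in> Y \<or> u \<in> Y \<and> v \<in> X \<or> u \<in> insert x0 W \<and> v \<in> insert x0 W)" (is "_ \<longleftrightarrow> ?R")
    proof
      assume e: "adj G u v"
      have uv: "u \<in> verts G" "v \<in> verts G" "adj G v u" "u \<noteq> v" using e E_in E_sym E_irrefl by blast+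
      then show ?R using ind[OF e] out[OF e] out[OF uv(3)] b(4) by blast
    next
      assume R: ?R
      then show "adj G u v" using comp clique E_sym by blast
    qed
  qed
qed

lemma admissible_iff:
  assumes "l \<ge> 1" "r \<ge> 1"
  shows "G \<in> admissible l r n \<longleftrightarrow> simple_graph G \<and> card (verts G) = n \<and>
    cycle_lists (adj G) (verts G) (2 * l + 1) = {} \<and> \<not> colorable (r - 1) G"
  using free_of_cycle[of G "2 * l + 1"] chromatic_number_ge_iff[of G r] assms
  by (auto simp: admissible_def)

lemma Tstar_admissible:
  assumes l: "l \<ge> 1" and a: "a \<ge> 2" and r: "r \<ge> 1" "r \<le> 2 * l" and n: "n \<ge> r + 1" and G: "G \<in> Tstar r n"
  shows "G \<in> admissible l r n" 
    "card (cycle_lists (adj G) (verts G) (2 * a)) = balanced_count a (n + 1 - r) + falling r (2 * a)"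
proof -
  obtain X Y W x0 where T: "Tstar_shape r (n + 1 - r) G X Y W x0"
    using G Tstar_iff[of r n G] r n by auto
  note c = Tstar_shape_counts[OF T r(1) a r(2)]
  have "simple_graph G" using T by (simp add: Tstar_shape_def)
  then show "G \<in> admissible l r n" using c l r n by (simp add: admissible_iff)
  show "card (cycle_lists (adj G) (verts G) (2 * a)) = balanced_count a (n + 1 - r) + falling r (2 * a)" by fact
qed

text \<open>An admissible graph with fewer than \<open>balanced_count a (n + 1 - r)\<close> lists is already below the bound; any other
one has the glued structure, for which \<open>glued_upper_bound\<close> settles the equality case.\<close>

lemma admissible_cycle_bound:
  fixes l a r n :: nat
  defines "\<delta> \<equiv> degree_threshold a r" and "K \<equiv> real (r + 2 * a + 8 * l)"
  assumes l: "l \<ge> 2" and a: "a \<ge> 2" and r: "r \<ge> 3" and G: "G \<in> admissible l r n"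
    and big: "real n \<ge> 200 * K" "real n \<ge> 40 * K / \<delta>" "real n \<ge> (4 * l + 20) / \<delta>"
      "real n \<ge> (4 * K / \<delta> + 2) / \<delta>" "real n \<ge> 8 * (2 + a + 4 * K / \<delta>)"
  defines "N \<equiv> balanced_count a (n + 1 - r) + falling r (2 * a)"
  shows "card (cycle_lists (adj G) (verts G) (2 * a)) < N \<or>
    card (cycle_lists (adj G) (verts G) (2 * a)) = N \<and> G \<in> Tstar r n"
proof (cases "balanced_count a (n + 1 - r) \<le> card (cycle_lists (adj G) (verts G) (2 * a))")
  case False
  then show ?thesis by (simp add: N_def)
next
  case True
  have adm: "simple_graph G" "card (verts G) = n" "cycle_lists (adj G) (verts G) (2 * l + 1) = {}"
    "\<not> colorable (r - 1) G"
    using G admissible_iff[of l r G n] l r by auto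
  interpret fin_graph "verts G" "adj G" by (rule fin_graph_adj[OF adm(1)])
  have ncol: "\<not> proper_colorable (r - 1)" using adm(4) by (simp add: proper_colorable_def colorable_def adj_def)
  obtain X Y W x0 where g: "glued X Y W x0" and c: "card W = r - 1" "a \<le> card X" "a \<le> card Y"
    and clique: "\<forall>u\<in>insert x0 W. \<forall>v\<in>insert x0 W. u \<noteq> v \<longrightarrow> adj G u v"
    using extremal_glued[OF l a r adm(2)[symmetric] adm(3) ncol True refl refl] big
    unfolding \<delta>_def K_def by blast
  have m: "card X + card Y = n + 1 - r" using glued_cards(1)[OF g] c adm(2) r by simp
  have rW: "Suc (card W) = r" using c r by simp
  note ub = glued_upper_bound[OF g a c(2,3), unfolded m rW, folded N_def]
  show ?thesis
  proof (cases "card (cycle_lists (adj G) (verts G) (2 * a)) = N")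
    case True
    then have comp: "\<forall>x\<in>X. \<forall>y\<in>Y. adj G x y" and balanced_count: "card X = (n + 1 - r) div 2 \<or> card Y = (n + 1 - r) div 2"
      using ub(2) by blast+
    have comp': "\<forall>y\<in>Y. \<forall>x\<in>X. adj G y x" using comp E_sym by blast
    have "\<exists>X Y W x0. Tstar_shape r (n + 1 - r) G X Y W x0"
      using balanced_count
    proof
      assume X: "card X = (n + 1 - r) div 2"
      then have "card Y = n + 1 - r - (n + 1 - r) div 2" using m by linarith
      from glued_imp_Tstar_shape[OF adm(1) g X this c(1) comp clique] show ?thesis by blast
    next
      assume Y: "card Y = (n + 1 - r) div 2"
      then have "card X = n + 1 - r - (n + 1 - r) div 2" using m by linarith
      from glued_imp_Tstar_shape[OF adm(1) glued_sym[OF g] Y this c(1) comp' clique] show ?thesis by blast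
    qed
    moreover have "n + 1 - r \<ge> 2" using m c a by linarith
    ultimately show ?thesis using True Tstar_iff[of r n G] r by simp
  next
    case False
    then show ?thesis using ub(1) by simp
  qed
qed

text \<open>By \<open>card_cycle_lists\<close> the bound on cyclic lists becomes one on copies. It also makes the set of values
finite, although there are infinitely many admissible graphs on natural numbers, so that the maximum is
meaningful.\<close>

theorem corollary1p6:
  fixes l a r :: nat
  assumes "l \<ge> 2" and "a \<ge> 2" and "3 \<le> r" and "r \<le> 2 * l - 1"
  shows "\<forall>\<^sub>F n in sequentially.
    (\<forall>T \<in> (Tstar r n :: nat graph set).
       Max {num_copies (cycle_graph (2 * a)) G | G. G \<in> admissible l r n}
         = num_copies (cycle_graph (2 * a)) T) \<and>
    {G \<in> admissible l r n. num_copies (cycle_graph (2 * a)) G =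
       Max {num_copies (cycle_graph (2 * a)) G' | G'. G' \<in> admissible l r n}}
      = Tstar r n"
proof -
  define \<delta> K where "\<delta> = degree_threshold a r" and "K = real (r + 2 * a + 8 * l)"
  have large: "\<forall>\<^sub>F n in sequentially. real n \<ge> C" for C
    using filterlim_real_sequentially eventually_ge_at_top[of C] by (auto simp: filterlim_iff)
  have "\<forall>\<^sub>F n in sequentially. real n \<ge> 200 * K \<and> real n \<ge> 40 * K / \<delta> \<and> real n \<ge> (4 * l + 20) / \<delta> \<and>
      real n \<ge> (4 * K / \<delta> + 2) / \<delta> \<and> real n \<ge> 8 * (2 + a + 4 * K / \<delta>)"
    by (intro eventually_conj large)
  then show ?thesis
  proof eventually_elim
    case (elim n)
    then have big: "real n \<ge> 200 * K" "real n \<ge> 40 * K / \<delta>" "real n \<ge> (4 * l + 20) / \<delta>"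
      "real n \<ge> (4 * K / \<delta> + 2) / \<delta>" "real n \<ge> 8 * (2 + a + 4 * K / \<delta>)" by auto
    have "real (r + 1) \<le> 200 * K" using assms(3) by (simp add: K_def)
    then have "real (r + 1) \<le> real n" using big(1) by linarith
    then have n: "n \<ge> r + 1" by (simp only: of_nat_le_iff)
    define t N k where "t = 2 * a" and "N = balanced_count a (n + 1 - r) + falling r (2 * a)"
      and "k = card (traversals t (cycle_graph t))"
    define num :: "nat graph \<Rightarrow> nat" where "num = num_copies (cycle_graph t)"
    have k: "k > 0" unfolding k_def by (rule card_traversals_pos)
    have t3: "t \<ge> 3" using assms by (simp add: t_def)
    have num: "card (cycle_lists (adj G) (verts G) (2 * a)) = k * num G" if "G \<in> admissible l r n" for G :: "nat graph"
      using card_cycle_lists[of G t] that t3 by (simp add: admissible_def num_def k_def t_def)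
    have upper: "k * num G < N \<or> k * num G = N \<and> G \<in> Tstar r n" if "G \<in> admissible l r n" for G :: "nat graph"
      using admissible_cycle_bound[OF assms(1,2,3) that big[unfolded \<delta>_def K_def]] num[OF that]
      by (simp add: N_def)
    have T: "G \<in> admissible l r n" "k * num G = N" if "G \<in> Tstar r n" for G :: "nat graph"
      using Tstar_admissible[of l a r n G] that assms n num[of G] by (auto simp: N_def)
    have "n + 1 - r \<ge> 2" "r \<ge> 1" using n assms(3) by auto
    then obtain T0 :: "nat graph" where T0: "T0 \<in> Tstar r n"
      using Tstar_shape_exists[of "n + 1 - r" r] Tstar_iff[of r n] by blast
    have Neq: "N = k * num T0" using T(2)[OF T0] by simp
    have le: "num G \<le> num T0" if "G \<in> admissible l r n" for G
      using upper[OF that] k unfolding Neq by auto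
    have eq: "num G = num T0 \<longleftrightarrow> G \<in> Tstar r n" if "G \<in> admissible l r n" for G
      using upper[OF that] T(2)[of G] k unfolding Neq by auto
    have max: "Max {num G | G. G \<in> admissible l r n} = num T0"
    proof (rule Max_eqI)
      show "finite {num G | G. G \<in> admissible l r n}"
        by (rule finite_subset[of _ "{..num T0}"]) (use le in auto)
      show "num T0 \<in> {num G | G. G \<in> admissible l r n}" using T(1)[OF T0] by blast
      show "y \<le> num T0" if "y \<in> {num G | G. G \<in> admissible l r n}" for y using that le by blast
    qed
    show ?case
      unfolding t_def[symmetric] num_def[symmetric] max
    proof (intro conjI ballI)
      show "num T0 = num T" if "T \<in> Tstar r n" for T using eq[OF T(1)[OF that]] that by simp
      show "{G \<in> admissible l r n. num G = num T0} = Tstar r n" using eq T(1) by blast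
    qed
  qed
qed

end
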